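(* Let $F_d$ be a free group on $d\geq 2$ generators and let $S$ be the standard symmetric generating set (the free generators and their inverses). Write $\delta(H)$ for the critical exponent of a subgroup $H\subset F_d$ with respect to $S$. Suppose $H_1\subset F_d$ is a co-amenable subgroup and $H_2$ is an ergodic invariant random subgroup of $F_d$. Then \[ \delta(H_1\cap H_2)=\delta(H_2)\] almost surely.
   Context: The critical exponent of a subgroup $H\subset F_d$ is the exponential growth rate $\delta(H)=\limsup_{n\to\infty}\frac1n\log|\{h\in H : |h|\le n\}|$, where $|\cdot|$ is word length with respect to $S$. For a finite symmetric subset $T$ of a countable group $\Gamma$ and a subgroup $H\subset \Gamma$, the co-spectral radius of $H$ with respect to $T$ is the operator norm of $M\colon L^2(\Gamma/H)\to L^2(\Gamma/H)$, $M\phi(\gamma H)=\frac{1}{|T|}\sum_{s\in T}\phi(s\gamma H)$. A subgroup $H$ is co-amenable in $\Gamma$ if its co-spectral radius equals $1$ for every choice of $T$ (for finitely generated $\Gamma$, equivalently for some finite symmetric generating set). Let $\mathrm{Sub}_\Gamma$ be the space of subgroups of $\Gamma$ with the topology induced from $\{0,1\}^\Gamma$. An invariant random subgroup of $\Gamma$ is a random subgroup whose distribution is a Borel probability measure on $\mathrm{Sub}_\Gamma$ invariant under conjugation by $\Gamma$; it is ergodic if this measure is ergodic for the conjugation action. *)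

theory Defs
  imports
    "HOL-Algebra.Left_Coset"
    "HOL-Probability.Probability_Measure"
begin

section \<open>Free groups\<close>

text \<open>
  A word is a list of letters \<open>(x, b)\<close>; the letter \<open>(x, True)\<close> stands for \<open>x\<close> and
  \<open>(x, False)\<close> for its inverse.
\<close>

definition reduced_word :: "('a \<times> bool) list \<Rightarrow> bool" where
  "reduced_word w \<longleftrightarrow> successively (\<lambda>k l. \<not> (fst k = fst l \<and> snd k \<noteq> snd l)) w"

definition letter_value :: "('a, 'm) monoid_scheme \<Rightarrow> 'a \<times> bool \<Rightarrow> 'a" where
  "letter_value G l = (if snd l then fst l else inv\<^bsub>G\<^esub> (fst l))"

definition word_value :: "('a, 'm) monoid_scheme \<Rightarrow> ('a \<times> bool) list \<Rightarrow> 'a" where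
  "word_value G w = foldr (\<lambda>l g. letter_value G l \<otimes>\<^bsub>G\<^esub> g) w \<one>\<^bsub>G\<^esub>"

definition free_basis :: "('a, 'm) monoid_scheme \<Rightarrow> 'a set \<Rightarrow> bool" where
  "free_basis G X \<longleftrightarrow> X \<subseteq> carrier G \<and>
     (\<forall>g\<in>carrier G. \<exists>!w. reduced_word w \<and> set w \<subseteq> X \<times> UNIV \<and> word_value G w = g)"

definition symmetric_generators :: "('a, 'm) monoid_scheme \<Rightarrow> 'a set \<Rightarrow> 'a set" where
  "symmetric_generators G X = X \<union> (\<lambda>x. inv\<^bsub>G\<^esub> x) ` X"


section \<open>Word length and critical exponent\<close>

definition word_length :: "('a, 'm) monoid_scheme \<Rightarrow> 'a set \<Rightarrow> 'a \<Rightarrow> nat" where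
  "word_length G S g =
     (LEAST n. \<exists>ss. length ss = n \<and> set ss \<subseteq> S \<and> foldr (\<lambda>s h. s \<otimes>\<^bsub>G\<^esub> h) ss \<one>\<^bsub>G\<^esub> = g)"

definition critical_exponent :: "('a, 'm) monoid_scheme \<Rightarrow> 'a set \<Rightarrow> 'a set \<Rightarrow> ereal" where
  "critical_exponent G S H =
     limsup (\<lambda>n::nat. ereal (1 / real n * ln (real (card {h \<in> H. word_length G S h \<le> n}))))"


section \<open>Co-amenability\<close>

definition square_summable :: "'i set \<Rightarrow> ('i \<Rightarrow> complex) set" where
  "square_summable I = {\<phi>. (\<lambda>i. (cmod (\<phi> i))\<^sup>2) summable_on I}"

definition l2_norm :: "'i set \<Rightarrow> ('i \<Rightarrow> complex) \<Rightarrow> real" where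
  "l2_norm I \<phi> = sqrt (\<Sum>\<^sub>\<infinity>i\<in>I. (cmod (\<phi> i))\<^sup>2)"

definition l2_operator_norm :: "'i set \<Rightarrow> (('i \<Rightarrow> complex) \<Rightarrow> ('i \<Rightarrow> complex)) \<Rightarrow> real" where
  "l2_operator_norm I A = (SUP \<phi>\<in>{\<phi> \<in> square_summable I. l2_norm I \<phi> \<le> 1}. l2_norm I (A \<phi>))"

definition markov_operator ::
    "('a, 'm) monoid_scheme \<Rightarrow> 'a set \<Rightarrow> ('a set \<Rightarrow> complex) \<Rightarrow> ('a set \<Rightarrow> complex)" where
  "markov_operator G T \<phi> C = 1 / of_nat (card T) * (\<Sum>s\<in>T. \<phi> (s <#\<^bsub>G\<^esub> C))"

definition cospectral_radius :: "('a, 'm) monoid_scheme \<Rightarrow> 'a set \<Rightarrow> 'a set \<Rightarrow> real" where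
  "cospectral_radius G T H = l2_operator_norm (lcosets\<^bsub>G\<^esub> H) (markov_operator G T)"

text \<open>
  The empty set has to be excluded: the average over it is the zero operator, of norm \<open>0\<close>.
\<close>

definition co_amenable :: "('a, 'm) monoid_scheme \<Rightarrow> 'a set \<Rightarrow> bool" where
  "co_amenable G H \<longleftrightarrow> subgroup H G \<and>
     (\<forall>T. finite T \<and> T \<noteq> {} \<and> T \<subseteq> carrier G \<and> (\<forall>s\<in>T. inv\<^bsub>G\<^esub> s \<in> T) \<longrightarrow>
        cospectral_radius G T H = 1)"


section \<open>Invariant random subgroups\<close>

definition subgroup_topology :: "('a, 'm) monoid_scheme \<Rightarrow> 'a set topology" where
  "subgroup_topology G =
     pullback_topology {H. subgroup H G} (\<lambda>H. \<lambda>g\<in>carrier G. g \<in> H)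
       (product_topology (\<lambda>_. discrete_topology (UNIV :: bool set)) (carrier G))"

definition subgroup_borel :: "('a, 'm) monoid_scheme \<Rightarrow> 'a set measure" where
  "subgroup_borel G =
     sigma (topspace (subgroup_topology G)) {U. openin (subgroup_topology G) U}"

definition conjugate_subgroup :: "('a, 'm) monoid_scheme \<Rightarrow> 'a \<Rightarrow> 'a set \<Rightarrow> 'a set" where
  "conjugate_subgroup G g H = (\<lambda>h. g \<otimes>\<^bsub>G\<^esub> h \<otimes>\<^bsub>G\<^esub> inv\<^bsub>G\<^esub> g) ` H"

definition conjugation_invariant :: "('a, 'm) monoid_scheme \<Rightarrow> 'a set measure \<Rightarrow> bool" where
  "conjugation_invariant G \<mu> \<longleftrightarrow> (\<forall>g\<in>carrier G. distr \<mu> \<mu> (conjugate_subgroup G g) = \<mu>)"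

definition conjugation_ergodic :: "('a, 'm) monoid_scheme \<Rightarrow> 'a set measure \<Rightarrow> bool" where
  "conjugation_ergodic G \<mu> \<longleftrightarrow>
     (\<forall>A\<in>sets \<mu>. (\<forall>g\<in>carrier G. conjugate_subgroup G g ` A = A) \<longrightarrow>
        emeasure \<mu> A = 0 \<or> emeasure \<mu> A = 1)"

text \<open>A random subgroup is a random variable on a probability space \<open>P\<close> with values in
  the space of subgroups.\<close>

definition ergodic_invariant_random_subgroup ::
    "('a, 'm) monoid_scheme \<Rightarrow> 'w measure \<Rightarrow> ('w \<Rightarrow> 'a set) \<Rightarrow> bool" where
  "ergodic_invariant_random_subgroup G P H \<longleftrightarrow>
     prob_space P \<and> H \<in> measurable P (subgroup_borel G) \<and>
     conjugation_invariant G (distr P (subgroup_borel G) H) \<and>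
     conjugation_ergodic G (distr P (subgroup_borel G) H)"


section \<open>Sanity checks\<close>

lemma topspace_subgroup_topology: "topspace (subgroup_topology G) = {H. subgroup H G}"
  by (auto simp: subgroup_topology_def topspace_pullback_topology)

lemma space_subgroup_borel: "space (subgroup_borel G) = {H. subgroup H G}"
  by (auto simp: subgroup_borel_def topspace_subgroup_topology space_measure_of_conv)

lemma sets_subgroup_borel:
  "sets (subgroup_borel G) =
     sigma_sets {H. subgroup H G} {U. openin (subgroup_topology G) U}"
proof -
  have "{U. openin (subgroup_topology G) U} \<subseteq> Pow (topspace (subgroup_topology G))"
    by (auto dest: openin_subset)
  then show ?thesis
    by (simp add: subgroup_borel_def topspace_subgroup_topology sets_measure_of)
qed

context group
begin

lemma letter_value_closed: "fst l \<in> carrier G \<Longrightarrow> letter_value G l \<in> carrier G"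
  by (simp add: letter_value_def)

lemma word_value_Nil [simp]: "word_value G [] = \<one>"
  by (simp add: word_value_def)

lemma word_value_Cons [simp]: "word_value G (l # w) = letter_value G l \<otimes> word_value G w"
  by (simp add: word_value_def)

lemma word_value_closed: "fst ` set w \<subseteq> carrier G \<Longrightarrow> word_value G w \<in> carrier G"
  by (induction w) (auto intro!: m_closed letter_value_closed)

lemma word_value_append:
  "fst ` set v \<subseteq> carrier G \<Longrightarrow> fst ` set w \<subseteq> carrier G \<Longrightarrow>
   word_value G (v @ w) = word_value G v \<otimes> word_value G w"
  by (induction v) (auto simp: word_value_closed letter_value_closed m_assoc)

end

fun push_letter :: "'a \<times> bool \<Rightarrow> ('a \<times> bool) list \<Rightarrow> ('a \<times> bool) list" where
  "push_letter l [] = [l]"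
| "push_letter l (k # w) = (if fst l = fst k \<and> snd l \<noteq> snd k then w else l # k # w)"

definition reduce :: "('a \<times> bool) list \<Rightarrow> ('a \<times> bool) list" where
  "reduce w = foldr push_letter w []"

lemma reduced_word_push: "reduced_word w \<Longrightarrow> reduced_word (push_letter l w)"
  by (cases w) (auto simp: reduced_word_def successively_Cons)

lemma reduced_word_reduce: "reduced_word (reduce w)"
  by (induction w) (auto simp: reduce_def reduced_word_push, simp add: reduced_word_def)

lemma set_push_letter: "set (push_letter l w) \<subseteq> insert l (set w)"
  by (cases w) auto

lemma set_reduce: "set (reduce w) \<subseteq> set w"
  by (induction w) (use set_push_letter in \<open>fastforce simp: reduce_def\<close>)+

lemma (in group) word_value_push:
  assumes "fst l \<in> carrier G" "fst ` set w \<subseteq> carrier G"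
  shows "word_value G (push_letter l w) = letter_value G l \<otimes> word_value G w"
proof (cases w)
  case (Cons k v)
  have "word_value G v \<in> carrier G"
    using assms Cons by (auto intro: word_value_closed)
  then show ?thesis
    using assms Cons
    by (auto simp: letter_value_def m_assoc [symmetric])
qed (use assms in simp)

lemma (in group) word_value_reduce:
  "fst ` set w \<subseteq> carrier G \<Longrightarrow> word_value G (reduce w) = word_value G w"
proof (induction w)
  case (Cons l w)
  have "fst ` set (reduce w) \<subseteq> carrier G"
    using Cons.prems set_reduce [of w] by auto
  then show ?case
    using Cons word_value_push [of l "reduce w"] by (simp add: reduce_def)
qed (simp add: reduce_def)

lemma map_push_letter_value:
  assumes "group K" "f (fst l) \<in> carrier K" "(f \<circ> fst) ` set w \<subseteq> carrier K"
  shows "word_value K (map (apfst f) (push_letter l w)) =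
         letter_value K (apfst f l) \<otimes>\<^bsub>K\<^esub> word_value K (map (apfst f) w)"
proof -
  interpret K: group K by fact
  show ?thesis
  proof (cases w)
    case (Cons k v)
    have "word_value K (map (apfst f) v) \<in> carrier K"
      using assms Cons by (intro K.word_value_closed) (auto simp: image_image)
    then show ?thesis
      using assms Cons by (auto simp: letter_value_def K.m_assoc [symmetric])
  qed (use assms in simp)
qed

lemma map_reduce_value:
  assumes "group K" "(f \<circ> fst) ` set w \<subseteq> carrier K"
  shows "word_value K (map (apfst f) (reduce w)) = word_value K (map (apfst f) w)"
  using assms(2)
proof (induction w)
  case (Cons l w)
  interpret K: group K by fact
  have "(f \<circ> fst) ` set (reduce w) \<subseteq> carrier K"
    using Cons.prems set_reduce [of w] by auto
  then show ?case
    using Cons map_push_letter_value [OF assms(1), of f l "reduce w"]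
    by (simp add: reduce_def)
qed (simp add: reduce_def)

text \<open>A free basis satisfies the universal property of free groups.\<close>

lemma free_basis_universal:
  assumes "group G" "group K" "free_basis G X" and f: "f \<in> X \<rightarrow> carrier K"
  shows "\<exists>\<phi>\<in>hom G K. (\<forall>x\<in>X. \<phi> x = f x) \<and>
           (\<forall>\<psi>\<in>hom G K. (\<forall>x\<in>X. \<psi> x = f x) \<longrightarrow> (\<forall>g\<in>carrier G. \<psi> g = \<phi> g))"
proof -
  interpret G: group G by fact
  interpret K: group K by fact
  have X: "X \<subseteq> carrier G"
    and ex1: "\<And>g. g \<in> carrier G \<Longrightarrow>
      \<exists>!w. reduced_word w \<and> set w \<subseteq> X \<times> UNIV \<and> word_value G w = g"
    using assms(3) by (auto simp: free_basis_def)
  define nf where "nf g = (THE w. reduced_word w \<and> set w \<subseteq> X \<times> UNIV \<and> word_value G w = g)" for g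
  have nf: "reduced_word (nf g)" "set (nf g) \<subseteq> X \<times> UNIV" "word_value G (nf g) = g"
    if "g \<in> carrier G" for g
    using theI' [OF ex1 [OF that]] by (auto simp: nf_def)
  have nf_eq: "nf (word_value G w) = reduce w" if "set w \<subseteq> X \<times> UNIV" for w
  proof -
    have w: "fst ` set w \<subseteq> carrier G"
      using that X by auto
    have "reduced_word (reduce w) \<and> set (reduce w) \<subseteq> X \<times> UNIV \<and>
        word_value G (reduce w) = word_value G w"
      using reduced_word_reduce set_reduce that G.word_value_reduce [OF w] by blast
    then show ?thesis
      using ex1 [OF G.word_value_closed [OF w]] nf [OF G.word_value_closed [OF w]] by blast
  qed
  define \<phi> where "\<phi> g = word_value K (map (apfst f) (nf g))" for g
  have \<phi>_word: "\<phi> (word_value G w) = word_value K (map (apfst f) w)"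
    if "set w \<subseteq> X \<times> UNIV" for w
  proof -
    have "(f \<circ> fst) ` set w \<subseteq> carrier K"
      using that f by auto
    then show ?thesis
      by (simp add: \<phi>_def nf_eq [OF that] map_reduce_value [OF assms(2)])
  qed
  have closed: "fst ` set (map (apfst f) w) \<subseteq> carrier K" if "set w \<subseteq> X \<times> UNIV" for w
    using that f by auto
  have hom: "\<phi> \<in> hom G K"
  proof (rule homI)
    show "\<phi> g \<in> carrier K" if "g \<in> carrier G" for g
      unfolding \<phi>_def by (intro K.word_value_closed closed nf that)
    show "\<phi> (g \<otimes>\<^bsub>G\<^esub> h) = \<phi> g \<otimes>\<^bsub>K\<^esub> \<phi> h" if "g \<in> carrier G" "h \<in> carrier G" for g h
    proof -
      have sub: "fst ` set (nf g) \<subseteq> carrier G" "fst ` set (nf h) \<subseteq> carrier G"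
        using nf(2) [OF that(1)] nf(2) [OF that(2)] X by auto
      have "g \<otimes>\<^bsub>G\<^esub> h = word_value G (nf g @ nf h)"
        using G.word_value_append [OF sub] nf(3) that by simp
      then have "\<phi> (g \<otimes>\<^bsub>G\<^esub> h) = word_value K (map (apfst f) (nf g @ nf h))"
        using \<phi>_word [of "nf g @ nf h"] nf(2) that by simp
      also have "\<dots> = \<phi> g \<otimes>\<^bsub>K\<^esub> \<phi> h"
        unfolding map_append \<phi>_def
        by (intro K.word_value_append closed nf that)
      finally show ?thesis .
    qed
  qed
  have gen: "\<phi> x = f x" if "x \<in> X" for x
  proof -
    have "x \<in> carrier G" "f x \<in> carrier K"
      using that X f by auto
    then show ?thesis
      using \<phi>_word [of "[(x, True)]"] that by (simp add: letter_value_def)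
  qed
  have "\<psi> g = \<phi> g" if \<psi>: "\<psi> \<in> hom G K" "\<forall>x\<in>X. \<psi> x = f x" and g: "g \<in> carrier G" for \<psi> g
  proof -
    interpret \<psi>: group_hom G K \<psi>
      using \<psi>(1) by unfold_locales
    have "\<psi> (word_value G w) = word_value K (map (apfst f) w)"
      if "set w \<subseteq> X \<times> UNIV" for w
      using that
    proof (induction w)
      case (Cons l w)
      have "fst l \<in> X" "fst l \<in> carrier G" "fst ` set w \<subseteq> carrier G"
        using Cons.prems X by auto
      then show ?case
        using Cons \<psi>(2) G.word_value_closed [of w]
        by (auto simp: letter_value_def)
    qed simp
    then show ?thesis
      using nf [OF g] by (metis \<phi>_def)
  qed
  with hom gen show ?thesis
    by blast
qed

text \<open>Reduced words with reduced concatenation form a group for which the letters are a free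
  basis, so free groups of every rank exist.\<close>

definition reduced_words :: "'x set \<Rightarrow> ('x \<times> bool) list monoid" where
  "reduced_words B =
     \<lparr>carrier = {w. reduced_word w \<and> set w \<subseteq> B \<times> UNIV},
      monoid.mult = (\<lambda>v w. reduce (v @ w)), one = []\<rparr>"

lemma push_letter_cancel:
  "reduced_word w \<Longrightarrow> push_letter (x, b) (push_letter (x, \<not> b) w) = w"
  by (cases w rule: remdups_adj.cases) (auto simp: reduced_word_def)

lemma reduce_reduced: "reduced_word w \<Longrightarrow> reduce w = w"
proof (induction w)
  case (Cons l w)
  then have "reduce w = w"
    by (auto simp: reduced_word_def successively_Cons)
  with Cons.prems show ?case
    by (cases w) (auto simp: reduce_def reduced_word_def)
qed (simp add: reduce_def)

lemma reduced_word_foldr_push: "reduced_word w \<Longrightarrow> reduced_word (foldr push_letter v w)"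
  by (induction v) (auto intro: reduced_word_push)

lemma foldr_push_push:
  assumes "reduced_word w"
  shows "foldr push_letter (push_letter l v) w = push_letter l (foldr push_letter v w)"
proof (cases v)
  case (Cons k u)
  show ?thesis
  proof (cases "fst l = fst k \<and> snd l \<noteq> snd k")
    case True
    then have "l = (fst k, \<not> snd k)"
      by (cases l) auto
    then show ?thesis
      using Cons push_letter_cancel [OF reduced_word_foldr_push [OF assms], of "fst k" "\<not> snd k" u]
      by simp
  next
    case False
    then show ?thesis
      using Cons by auto
  qed
qed simp

lemma foldr_push_reduce:
  "reduced_word w \<Longrightarrow> foldr push_letter (reduce v) w = foldr push_letter v w"
  by (induction v) (simp_all add: reduce_def foldr_push_push)

lemma reduce_append: "reduce (v @ w) = foldr push_letter v (reduce w)"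
  by (simp add: reduce_def)

lemma reduce_append_reduce_left: "reduce (reduce v @ w) = reduce (v @ w)"
  by (simp add: reduce_append foldr_push_reduce reduced_word_reduce)

lemma reduce_append_reduce_right: "reduce (v @ reduce w) = reduce (v @ w)"
  by (simp add: reduce_append reduce_reduced reduced_word_reduce)

lemma reduce_inverse: "reduce (rev (map (apsnd Not) w) @ w) = []"
proof (induction w)
  case (Cons l w)
  have "push_letter (apsnd Not l) (push_letter l (reduce w)) = reduce w"
    using push_letter_cancel [OF reduced_word_reduce, of "fst l" "\<not> snd l" w]
    by (cases l) simp
  with Cons show ?case
    by (simp add: reduce_append) (simp add: reduce_def)
qed (simp add: reduce_def)

lemma group_reduced_words: "group (reduced_words B)"
proof (rule groupI)
  fix u v w
  assume u: "u \<in> carrier (reduced_words B)" and v: "v \<in> carrier (reduced_words B)"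
  show "u \<otimes>\<^bsub>reduced_words B\<^esub> v \<in> carrier (reduced_words B)"
    using u v set_reduce [of "u @ v"] by (auto simp: reduced_words_def reduced_word_reduce)
  show "u \<otimes>\<^bsub>reduced_words B\<^esub> v \<otimes>\<^bsub>reduced_words B\<^esub> w =
      u \<otimes>\<^bsub>reduced_words B\<^esub> (v \<otimes>\<^bsub>reduced_words B\<^esub> w)"
    by (simp add: reduced_words_def reduce_append_reduce_left reduce_append_reduce_right)
  show "\<one>\<^bsub>reduced_words B\<^esub> \<otimes>\<^bsub>reduced_words B\<^esub> u = u"
    using u by (simp add: reduced_words_def reduce_reduced)
  show "\<exists>y\<in>carrier (reduced_words B). y \<otimes>\<^bsub>reduced_words B\<^esub> u = \<one>\<^bsub>reduced_words B\<^esub>"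
  proof
    let ?y = "reduce (rev (map (apsnd Not) u))"
    show "?y \<otimes>\<^bsub>reduced_words B\<^esub> u = \<one>\<^bsub>reduced_words B\<^esub>"
      by (simp add: reduced_words_def reduce_append_reduce_left reduce_inverse)
    show "?y \<in> carrier (reduced_words B)"
      using u set_reduce [of "rev (map (apsnd Not) u)"]
      by (fastforce simp: reduced_words_def reduced_word_reduce)
  qed
qed (simp add: reduced_words_def reduced_word_def)

lemma free_basis_reduced_words:
  "free_basis (reduced_words B) ((\<lambda>x. [(x, True)]) ` B)"
proof -
  let ?G = "reduced_words B"
  interpret G: group ?G
    by (rule group_reduced_words)
  let ?i = "\<lambda>x. [(x, True)]"
  have sub: "?i ` B \<subseteq> carrier ?G"
    by (auto simp: reduced_words_def reduced_word_def)
  have letter: "letter_value ?G (apfst ?i l) = [l]" if "fst l \<in> B" for l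
  proof (cases "snd l")
    case False
    have "inv\<^bsub>?G\<^esub> [(fst l, True)] = [(fst l, False)]"
      using that
      by (intro G.inv_equality)
        (auto simp: reduced_words_def reduced_word_def reduce_def)
    with False show ?thesis
      by (cases l) (simp add: letter_value_def)
  qed (cases l, simp add: letter_value_def)
  have "word_value ?G (map (apfst ?i) w) = reduce w" if "set w \<subseteq> B \<times> UNIV" for w
    using that
  proof (induction w)
    case (Cons l w)
    have "fst l \<in> B"
      using Cons.prems by auto
    then have "word_value ?G (map (apfst ?i) (l # w)) = reduce ([l] @ reduce w)"
      using Cons by (simp add: letter) (simp add: reduced_words_def)
    then show ?case
      by (simp only: reduce_append_reduce_right) simp
  next
    case Nil
    show ?case
      by (simp only: list.map G.word_value_Nil) (simp add: reduce_def reduced_words_def)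
  qed
  note val = this
  have lift: "\<exists>v. w = map (apfst ?i) v \<and> set v \<subseteq> B \<times> UNIV"
    if "set w \<subseteq> ?i ` B \<times> UNIV" for w :: "(('a \<times> bool) list \<times> bool) list"
    using that
  proof (induction w)
    case (Cons l w)
    then obtain v where "w = map (apfst ?i) v" "set v \<subseteq> B \<times> UNIV"
      by auto
    moreover obtain x where "x \<in> B" "l = apfst ?i (x, snd l)"
      using Cons.prems by (cases l) auto
    ultimately show ?case
      by (intro exI [of _ "(x, snd l) # v"]) auto
  qed simp
  have red: "reduced_word (map (apfst ?i) v) \<longleftrightarrow> reduced_word v" for v :: "('a \<times> bool) list"
    by (simp add: reduced_word_def successively_map)
  have "\<exists>!w. reduced_word w \<and> set w \<subseteq> ?i ` B \<times> UNIV \<and> word_value ?G w = g"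
    if "g \<in> carrier ?G" for g
  proof
    have "reduced_word g" "set g \<subseteq> B \<times> UNIV"
      using that by (auto simp: reduced_words_def)
    then show "reduced_word (map (apfst ?i) g) \<and> set (map (apfst ?i) g) \<subseteq> ?i ` B \<times> UNIV \<and>
        word_value ?G (map (apfst ?i) g) = g"
      by (auto simp: red val reduce_reduced)
  next
    fix w
    assume w: "reduced_word w \<and> set w \<subseteq> ?i ` B \<times> UNIV \<and> word_value ?G w = g"
    then obtain v where "w = map (apfst ?i) v" "set v \<subseteq> B \<times> UNIV"
      using lift by blast
    with w show "w = map (apfst ?i) g"
      using reduce_reduced [of v] by (simp add: red val)
  qed
  with sub show ?thesis
    by (simp add: free_basis_def)
qed

end

theory Submission
  imports Defs
begin

text \<open>
  Since \<open>\<delta>(H\<^sub>1 \<inter> K) \<le> \<delta>(K)\<close> for every subgroup \<open>K\<close>, it has to be excluded that the exponent drops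
  with positive probability when \<open>K\<close> is a sample of the invariant random subgroup. The proof plays
  two facts about the action of \<open>K\<close> on the cosets \<open>G/H\<^sub>1\<close> against each other.

  A coset \<open>\<gamma>H\<^sub>1\<close> has stabilizer \<open>K \<inter> \<gamma>H\<^sub>1\<gamma>\<^bsup>-1\<^esup>\<close> in \<open>K\<close>. On the set of cosets whose stabilizer grows at
  most like \<open>e\<^bsup>an\<^esup>\<close>, the sum of the translations by all \<open>z \<in> K\<close> of length \<open>n\<close> has norm at most a
  polynomial times \<open>e\<^bsup>bn\<^esup>\<close>, for any \<open>b > a\<close> with \<open>\<delta>(K) < 2b\<close>. This is a Schur test (\<open>schur_test\<close>)
  with a Poincare series as the test function (\<open>orbit_weight\<close>). It relies on the tree structure of
  the free group: a coset of \<open>K\<close> contains at most about \<open>e\<^bsup>2bl\<^esup>\<close> elements of length \<open>l\<close>,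
  uniformly over all cosets (\<open>card_words_into_coset_le\<close>). If \<open>K\<close> itself grows faster than
  \<open>e\<^bsup>bn\<^esup>\<close>, then for a suitable \<open>n\<close> this norm is at most half the number of translations.

  Co-amenability, on the other hand, provides unit vectors on \<open>G/H\<^sub>1\<close> that are almost fixed by all
  these translations (\<open>co_amenable_almost_invariant\<close>). Hence such vectors carry almost no mass on
  the cosets of small stabilizer (\<open>almost_invariant_mass_le\<close>).

  Finally, average over \<open>K\<close>. The stabilizer of \<open>\<gamma>H\<^sub>1\<close> is conjugate to \<open>\<gamma>\<^bsup>-1\<^esup>K\<gamma> \<inter> H\<^sub>1\<close>, and \<open>\<gamma>\<^bsup>-1\<^esup>K\<gamma>\<close> has
  the same law as \<open>K\<close>. So each coset has small stabilizer with the same probability, namely that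
  of a drop for \<open>K \<inter> H\<^sub>1\<close>, and this probability is the limit of the expected masses, which tend to
  \<open>0\<close> by dominated convergence (\<open>AE_no_growth_drop\<close>). The different sizes of a drop are exhausted
  by countably many pairs of rational rates (\<open>exponent_drop_witness\<close>).
\<close>

section \<open>Word length and cancellation in a free group\<close>

definition inverse_word :: "('a \<times> bool) list \<Rightarrow> ('a \<times> bool) list" where
  "inverse_word w = rev (map (apsnd Not) w)"

lemma length_inverse_word [simp]: "length (inverse_word w) = length w"
  by (simp add: inverse_word_def)

lemma inj_inverse_word: "inj inverse_word"
  by (rule inj_on_inverseI [of _ inverse_word])
     (simp add: inverse_word_def rev_map comp_def apsnd_def map_prod_def case_prod_beta)

lemma reduced_word_inverse: "reduced_word w \<Longrightarrow> reduced_word (inverse_word w)"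
  unfolding reduced_word_def inverse_word_def successively_rev successively_map
  by (erule successively_mono) auto

lemma reduced_word_inverse_append:
  assumes "reduced_word u" "reduced_word v" "u = [] \<or> v = [] \<or> hd u \<noteq> hd v"
  shows "reduced_word (inverse_word u @ v)"
proof -
  have "last (inverse_word u) = apsnd Not (hd u)" if "u \<noteq> []"
    using that by (simp add: inverse_word_def last_rev hd_map)
  then show ?thesis
    using assms reduced_word_inverse [OF assms(1)]
    by (auto simp: reduced_word_def successively_append_iff inverse_word_def prod_eq_iff)
qed

lemma set_inverse_word: "set w \<subseteq> X \<times> UNIV \<Longrightarrow> set (inverse_word w) \<subseteq> X \<times> UNIV"
  by (force simp: inverse_word_def)

lemma length_push_letter_le: "length (push_letter l w) \<le> Suc (length w)"
  by (cases w) auto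

lemma length_reduce_le: "length (reduce w) \<le> length w"
proof (induction w)
  case (Cons l w)
  then show ?case
    using length_push_letter_le [of l "reduce w"] by (simp add: reduce_def)
qed (simp add: reduce_def)

lemma common_prefix_split:
  obtains p u v where "x = p @ u" "y = p @ v" "u = [] \<or> v = [] \<or> hd u \<noteq> hd v"
proof (induction x arbitrary: y thesis)
  case Nil
  then show ?case by (metis append_Nil)
next
  case (Cons a x)
  show ?case
  proof (cases "y \<noteq> [] \<and> hd y = a")
    case True
    then obtain y' where y: "y = a # y'" by (cases y) auto
    obtain p u v where "x = p @ u" "y' = p @ v" "u = [] \<or> v = [] \<or> hd u \<noteq> hd v"
      by (rule Cons.IH)
    with y show ?thesis
      by (intro Cons.prems [of "a # p" u v]) auto
  next
    case False
    then show ?thesis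
      by (intro Cons.prems [of "[]" "a # x" y]) auto
  qed
qed

locale finitely_generated_free_group = group G for G (structure) +
  fixes X :: "'a set"
  assumes basis: "free_basis G X" and finite_basis: "finite X"
begin

definition basis_words :: "('a \<times> bool) list set" where
  "basis_words = {w. reduced_word w \<and> set w \<subseteq> X \<times> UNIV}"

definition normal_form :: "'a \<Rightarrow> ('a \<times> bool) list" where
  "normal_form = inv_into basis_words (word_value G)"

abbreviation len :: "'a \<Rightarrow> nat" where
  "len \<equiv> word_length G (symmetric_generators G X)"

lemma basis_subset: "X \<subseteq> carrier G"
  using basis by (simp add: free_basis_def)

lemma letters_in_carrier: "set w \<subseteq> X \<times> UNIV \<Longrightarrow> fst ` set w \<subseteq> carrier G"
  using basis_subset by auto

lemma word_value_in_carrier: "set w \<subseteq> X \<times> UNIV \<Longrightarrow> word_value G w \<in> carrier G"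
  by (intro word_value_closed letters_in_carrier)

lemma bij_betw_word_value: "bij_betw (word_value G) basis_words (carrier G)"
proof (rule bij_betwI')
  have unique: "\<exists>!w. reduced_word w \<and> set w \<subseteq> X \<times> UNIV \<and> word_value G w = g"
    if "g \<in> carrier G" for g
    using basis that by (auto simp: free_basis_def)
  show "word_value G u = word_value G v \<longleftrightarrow> u = v" if "u \<in> basis_words" "v \<in> basis_words" for u v
    using unique [of "word_value G u"] that word_value_in_carrier [of u]
    unfolding basis_words_def by auto
  show "word_value G u \<in> carrier G" if "u \<in> basis_words" for u
    using that word_value_in_carrier by (auto simp: basis_words_def)
  show "\<exists>w\<in>basis_words. g = word_value G w" if "g \<in> carrier G" for g
    using unique [OF that] by (auto simp: basis_words_def)
qed

lemma normal_form_in: "g \<in> carrier G \<Longrightarrow> normal_form g \<in> basis_words"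
  unfolding normal_form_def
  by (metis bij_betw_word_value bij_betw_imp_surj_on inv_into_into)

lemma word_value_normal_form: "g \<in> carrier G \<Longrightarrow> word_value G (normal_form g) = g"
  unfolding normal_form_def
  using bij_betw_word_value by (metis bij_betw_inv_into_right)

lemma normal_form_word_value: "w \<in> basis_words \<Longrightarrow> normal_form (word_value G w) = w"
  unfolding normal_form_def
  using bij_betw_word_value by (metis bij_betw_inv_into_left)

lemma reduce_in_basis_words: "set w \<subseteq> X \<times> UNIV \<Longrightarrow> reduce w \<in> basis_words"
  using set_reduce [of w] by (auto simp: basis_words_def reduced_word_reduce)

text \<open>
  Word length is defined through lists of group elements. A generator may be the value of two
  letters, so the translation into words chooses one for each entry.
\<close>

lemma generator_list_eq_word:
  assumes "set ss \<subseteq> symmetric_generators G X"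
  shows "\<exists>u. set u \<subseteq> X \<times> UNIV \<and> length u = length ss \<and>
    word_value G u = foldr (\<lambda>s h. s \<otimes> h) ss \<one>"
  using assms
proof (induction ss)
  case (Cons s ss)
  then obtain u where u: "set u \<subseteq> X \<times> UNIV" "length u = length ss"
    "word_value G u = foldr (\<lambda>s h. s \<otimes> h) ss \<one>"
    by auto
  obtain l where "l \<in> X \<times> UNIV" "letter_value G l = s"
  proof (cases "s \<in> X")
    case True
    then show ?thesis by (intro that [of "(s, True)"]) (auto simp: letter_value_def)
  next
    case False
    then obtain x where "x \<in> X" "s = inv x"
      using Cons.prems by (auto simp: symmetric_generators_def)
    then show ?thesis by (intro that [of "(x, False)"]) (auto simp: letter_value_def)
  qed
  with u show ?case
    by (intro exI [of _ "l # u"]) auto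
qed auto

lemma len_word_value:
  assumes "w \<in> basis_words"
  shows "len (word_value G w) = length w"
  unfolding word_length_def
proof (rule Least_equality)
  have "set (map (letter_value G) w) \<subseteq> symmetric_generators G X"
    using assms by (fastforce simp: basis_words_def symmetric_generators_def letter_value_def)
  moreover have "foldr (\<lambda>s h. s \<otimes> h) (map (letter_value G) w) \<one> = word_value G w"
    by (simp add: word_value_def foldr_map comp_def)
  ultimately show "\<exists>ss. length ss = length w \<and> set ss \<subseteq> symmetric_generators G X \<and>
      foldr (\<lambda>s h. s \<otimes> h) ss \<one> = word_value G w"
    by (intro exI [of _ "map (letter_value G) w"]) simp
next
  fix n
  assume "\<exists>ss. length ss = n \<and> set ss \<subseteq> symmetric_generators G X \<and>
      foldr (\<lambda>s h. s \<otimes> h) ss \<one> = word_value G w"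
  then obtain u where u: "set u \<subseteq> X \<times> UNIV" "length u = n" "word_value G u = word_value G w"
    using generator_list_eq_word by metis
  then have "word_value G (reduce u) = word_value G w"
    using word_value_reduce letters_in_carrier by metis
  then have "reduce u = w"
    using normal_form_word_value reduce_in_basis_words [OF u(1)] assms by metis
  then show "length w \<le> n"
    using length_reduce_le u(2) by metis
qed

lemma len_eq_length: "g \<in> carrier G \<Longrightarrow> len g = length (normal_form g)"
  using len_word_value normal_form_in word_value_normal_form by metis

lemma len_word_value_le:
  assumes "set w \<subseteq> X \<times> UNIV"
  shows "len (word_value G w) \<le> length w"
  using len_word_value [OF reduce_in_basis_words [OF assms]] length_reduce_le [of w]
    word_value_reduce [OF letters_in_carrier [OF assms]] by simp

lemma len_one [simp]: "len \<one> = 0"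
  using len_word_value [of "[]"] by (simp add: basis_words_def reduced_word_def)

lemma len_mult_le:
  assumes "g \<in> carrier G" "h \<in> carrier G"
  shows "len (g \<otimes> h) \<le> len g + len h"
proof -
  let ?u = "normal_form g" and ?v = "normal_form h"
  have sets: "set ?u \<subseteq> X \<times> UNIV" "set ?v \<subseteq> X \<times> UNIV"
    using normal_form_in assms by (auto simp: basis_words_def)
  then have "word_value G (?u @ ?v) = g \<otimes> h"
    using word_value_append [OF letters_in_carrier letters_in_carrier] word_value_normal_form assms
    by simp
  then show ?thesis
    using len_word_value_le [of "?u @ ?v"] sets by (simp add: len_eq_length assms)
qed

lemma word_value_inverse:
  "set w \<subseteq> X \<times> UNIV \<Longrightarrow> word_value G (inverse_word w) = inv (word_value G w)"
proof (induction w)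
  case (Cons l w)
  have l: "set [l] \<subseteq> X \<times> UNIV" and w: "set w \<subseteq> X \<times> UNIV"
    using Cons.prems by auto
  have lv: "letter_value G l \<in> carrier G"
    using l basis_subset by (auto intro!: letter_value_closed)
  have "letter_value G (apsnd Not l) = inv (letter_value G l)"
    using l basis_subset by (auto simp: letter_value_def)
  moreover have "word_value G (inverse_word (l # w)) =
      word_value G (inverse_word w) \<otimes> word_value G [apsnd Not l]"
    using word_value_append [of "inverse_word w" "[apsnd Not l]"] l basis_subset
      letters_in_carrier [OF set_inverse_word [OF w]]
    by (auto simp: inverse_word_def)
  ultimately show ?case
    using Cons.IH [OF w] lv word_value_in_carrier [OF w] by (simp add: inv_mult_group)
qed (simp add: inverse_word_def)

lemma inverse_word_in_basis_words: "w \<in> basis_words \<Longrightarrow> inverse_word w \<in> basis_words"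
  using reduced_word_inverse set_inverse_word by (auto simp: basis_words_def)

lemma len_inv:
  assumes "g \<in> carrier G"
  shows "len (inv g) = len g"
  using len_word_value [OF inverse_word_in_basis_words [OF normal_form_in [OF assms]]]
    word_value_inverse [of "normal_form g"] normal_form_in [OF assms]
    word_value_normal_form [OF assms] len_eq_length [OF assms]
  by (simp add: basis_words_def)

lemma finite_ball: "finite {g \<in> carrier G. len g \<le> n}"
  and card_ball_le: "card {g \<in> carrier G. len g \<le> n} \<le> (2 * card X + 1) ^ n"
proof -
  let ?L = "{w. set w \<subseteq> X \<times> (UNIV :: bool set) \<and> length w \<le> n}"
  have fin: "finite ?L"
    using finite_basis by (intro finite_lists_length_le) auto
  have sub: "{g \<in> carrier G. len g \<le> n} \<subseteq> word_value G ` ?L"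
  proof
    fix g assume g: "g \<in> {g \<in> carrier G. len g \<le> n}"
    then have "normal_form g \<in> ?L"
      using normal_form_in [of g] len_eq_length [of g] by (auto simp: basis_words_def)
    then show "g \<in> word_value G ` ?L"
      using word_value_normal_form [of g] g by force
  qed
  then show "finite {g \<in> carrier G. len g \<le> n}"
    using fin finite_surj by blast
  have "card {g \<in> carrier G. len g \<le> n} \<le> card ?L"
    using fin sub by (rule surj_card_le)
  also have "card ?L = (\<Sum>i\<le>n. (2 * card X) ^ i)"
    using finite_basis by (subst card_lists_length_le) (auto simp: card_cartesian_product mult.commute)
  also have "\<dots> \<le> (2 * card X + 1) ^ n"
  proof -
    have "(\<Sum>i\<le>n. a ^ i) \<le> (a + 1) ^ n" for a :: nat
    proof (induction n)
      case (Suc n)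
      moreover have "a * a ^ n \<le> a * (a + 1) ^ n"
        by (intro mult_left_mono power_mono) auto
      ultimately have "(\<Sum>i\<le>n. a ^ i) + a * a ^ n \<le> (a + 1) ^ n + a * (a + 1) ^ n"
        by (rule add_mono)
      then show ?case
        by (simp only: sum.atMost_Suc power_Suc) (simp add: algebra_simps)
    qed simp
    then show ?thesis .
  qed
  finally show "card {g \<in> carrier G. len g \<le> n} \<le> (2 * card X + 1) ^ n" .
qed

text \<open>
  The tree structure of the Cayley graph: the cancellation in \<open>z\<^bsup>-1\<^esup>g\<close> is exactly the common prefix
  of the normal forms.
\<close>

lemma len_inv_mult_eq:
  assumes "z \<in> carrier G" "g \<in> carrier G"
  obtains t where "t \<le> len z" "t \<le> len g"
    "take t (normal_form z) = take t (normal_form g)"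
    "len (inv z \<otimes> g) + 2 * t = len z + len g"
proof -
  obtain p u v where puv: "normal_form z = p @ u" "normal_form g = p @ v"
    "u = [] \<or> v = [] \<or> hd u \<noteq> hd v"
    by (rule common_prefix_split)
  have mem: "p @ u \<in> basis_words" "p @ v \<in> basis_words"
    using normal_form_in assms puv by metis+
  then have sets: "set p \<subseteq> X \<times> UNIV" "set u \<subseteq> X \<times> UNIV" "set v \<subseteq> X \<times> UNIV"
    by (auto simp: basis_words_def)
  have red: "reduced_word u" "reduced_word v"
    using mem by (auto simp: basis_words_def reduced_word_def successively_append_iff)
  have "z = word_value G p \<otimes> word_value G u" "g = word_value G p \<otimes> word_value G v"
    using puv word_value_normal_form assms word_value_append letters_in_carrier sets by metis+
  then have "inv z \<otimes> g = inv (word_value G u) \<otimes> word_value G v"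
    using word_value_in_carrier sets by (simp add: inv_mult_group inv_solve_left' m_assoc)
  also have "\<dots> = word_value G (inverse_word u @ v)"
    using word_value_append word_value_inverse sets letters_in_carrier set_inverse_word by metis
  finally have "len (inv z \<otimes> g) = length (inverse_word u @ v)"
    using len_word_value [of "inverse_word u @ v"] reduced_word_inverse_append [OF red puv(3)]
      set_inverse_word [OF sets(2)] sets by (simp add: basis_words_def)
  then show ?thesis
    using puv assms by (intro that [of "length p"]) (auto simp: len_eq_length)
qed

end

context finitely_generated_free_group
begin

section \<open>Exponential growth of subsets\<close>

text \<open>
  A multiplicative constant instead of a limit makes the bound stable under bounded changes of
  length, so invariance under conjugation is immediate; the critical exponent is the infimum of
  the admissible rates.
\<close>

definition growth_at_most :: "real \<Rightarrow> 'a set \<Rightarrow> bool" where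
  "growth_at_most s A \<longleftrightarrow> (\<exists>C. \<forall>n. real (card {g \<in> A. len g \<le> n}) \<le> C * exp (s * real n))"

lemma finite_ball_inter: "A \<subseteq> carrier G \<Longrightarrow> finite {g \<in> A. len g \<le> n}"
  by (rule finite_subset [OF _ finite_ball [of n]]) auto

lemma growth_at_most_transfer:
  assumes growth: "growth_at_most s A" and "s \<ge> 0" and A: "A \<subseteq> carrier G"
    and inj: "inj_on f B" and sub: "f ` B \<subseteq> A" and len: "\<And>g. g \<in> B \<Longrightarrow> len (f g) \<le> len g + c"
  shows "growth_at_most s B"
proof -
  obtain C where C: "\<And>n. real (card {g \<in> A. len g \<le> n}) \<le> C * exp (s * real n)"
    using growth by (auto simp: growth_at_most_def)
  have "real (card {g \<in> B. len g \<le> n}) \<le> C * exp (s * real c) * exp (s * real n)" for n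
  proof -
    have "card {g \<in> B. len g \<le> n} \<le> card {g \<in> A. len g \<le> n + c}"
    proof (rule card_inj_on_le)
      show "inj_on f {g \<in> B. len g \<le> n}"
        using inj by (rule inj_on_subset) auto
      show "f ` {g \<in> B. len g \<le> n} \<subseteq> {g \<in> A. len g \<le> n + c}"
        using sub len by fastforce
    qed (rule finite_ball_inter [OF A])
    then have "real (card {g \<in> B. len g \<le> n}) \<le> C * exp (s * real (n + c))"
      using C [of "n + c"] by linarith
    then show ?thesis
      by (simp add: algebra_simps exp_add)
  qed
  then show ?thesis
    by (auto simp: growth_at_most_def)
qed

lemma growth_at_most_mono:
  assumes "growth_at_most s A" "s \<le> t"
  shows "growth_at_most t A"
proof -
  obtain C where C: "\<And>n. real (card {g \<in> A. len g \<le> n}) \<le> C * exp (s * real n)"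
    using assms by (auto simp: growth_at_most_def)
  have "real (card {g \<in> A. len g \<le> n}) \<le> max C 0 * exp (t * real n)" for n
  proof -
    have "C * exp (s * real n) \<le> max C 0 * exp (t * real n)"
      using assms(2) by (intro mult_mono) (auto intro: mult_right_mono)
    with C [of n] show ?thesis by linarith
  qed
  then show ?thesis
    by (auto simp: growth_at_most_def)
qed

lemma growth_at_most_conjugate_iff:
  assumes "s \<ge> 0" "A \<subseteq> carrier G" "c \<in> carrier G"
  shows "growth_at_most s ((\<lambda>h. c \<otimes> h \<otimes> inv c) ` A) \<longleftrightarrow> growth_at_most s A"
proof
  let ?f = "\<lambda>h. c \<otimes> h \<otimes> inv c" and ?g = "\<lambda>h. inv c \<otimes> h \<otimes> c"
  have gf: "?g (?f h) = h" if "h \<in> A" for h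
  proof -
    have h: "h \<in> carrier G" using that assms by auto
    have "?g (?f h) = (inv c \<otimes> c) \<otimes> h \<otimes> (inv c \<otimes> c)"
      using h assms(3) by (simp only: m_assoc m_closed inv_closed)
    then show ?thesis
      using h assms(3) by simp
  qed
  have conj_len: "len (a \<otimes> h \<otimes> b) \<le> len h + (len a + len b)"
    if "a \<in> carrier G" "b \<in> carrier G" "h \<in> carrier G" for a b h
    using len_mult_le [of "a \<otimes> h" b] len_mult_le [of a h] that by simp
  show "growth_at_most s A" if "growth_at_most s (?f ` A)"
  proof (rule growth_at_most_transfer [OF that \<open>s \<ge> 0\<close>])
    show "?f ` A \<subseteq> carrier G"
      using assms by auto
    show "inj_on ?f A"
      using gf by (rule inj_on_inverseI)
    show "len (?f h) \<le> len h + (len c + len (inv c))" if "h \<in> A" for h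
      using conj_len that assms by auto
  qed simp
  show "growth_at_most s (?f ` A)" if "growth_at_most s A"
  proof (rule growth_at_most_transfer [OF that assms(1,2)])
    show "inj_on ?g (?f ` A)"
      using gf by (intro inj_on_inverseI [of _ ?f]) auto
    show "?g ` ?f ` A \<subseteq> A"
      using gf by (force simp: image_image)
    show "len (?g h) \<le> len h + (len (inv c) + len c)" if "h \<in> ?f ` A" for h
      using conj_len that assms by auto
  qed
qed

text \<open>
  The Poincare series at an exponent above the growth rate is dominated by a geometric series.
\<close>

lemma sum_exp_len_le:
  assumes "\<And>n. real (card {g \<in> A. len g \<le> n}) \<le> C * exp (a * real n)" "a < b"
    and "finite F" "F \<subseteq> A" "A \<subseteq> carrier G"
  shows "(\<Sum>g\<in>F. exp (- b * real (len g))) \<le> C / (1 - exp (a - b))"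
proof -
  have C: "C \<ge> 0"
    using order_trans [OF _ assms(1) [of 0]] by simp
  define m where "m = Max (insert 0 (len ` F))"
  have m: "len g \<le> m" if "g \<in> F" for g
    unfolding m_def using that \<open>finite F\<close> by (intro Max_ge) auto
  have "(\<Sum>g\<in>F. exp (- b * real (len g))) =
      (\<Sum>n\<le>m. \<Sum>g\<in>{g\<in>F. len g = n}. exp (- b * real (len g)))"
    using m \<open>finite F\<close> by (intro sum.group [symmetric]) auto
  also have "\<dots> = (\<Sum>n\<le>m. real (card {g\<in>F. len g = n}) * exp (- b * real n))"
    by simp
  also have "\<dots> \<le> (\<Sum>n\<le>m. C * exp (a - b) ^ n)"
  proof (rule sum_mono)
    fix n
    have "card {g\<in>F. len g = n} \<le> card {g \<in> A. len g \<le> n}"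
      using assms by (intro card_mono finite_ball_inter) auto
    then have "real (card {g\<in>F. len g = n}) \<le> C * exp (a * real n)"
      using assms(1) [of n] by linarith
    then have "real (card {g\<in>F. len g = n}) * exp (- b * real n) \<le>
        C * exp (a * real n) * exp (- b * real n)"
      by (intro mult_right_mono) auto
    also have "\<dots> = C * exp (a - b) ^ n"
      by (simp add: exp_of_nat_mult [symmetric] exp_add [symmetric] algebra_simps mult_exp_exp)
    finally show "real (card {g\<in>F. len g = n}) * exp (- b * real n) \<le> C * exp (a - b) ^ n" .
  qed
  also have "\<dots> = C * (\<Sum>n<Suc m. exp (a - b) ^ n)"
    by (simp add: sum_distrib_left lessThan_Suc_atMost)
  also have "\<dots> \<le> C * (1 / (1 - exp (a - b)))"
  proof (intro mult_left_mono C)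
    show "(\<Sum>n<Suc m. exp (a - b) ^ n) \<le> 1 / (1 - exp (a - b))"
      using assms(2) by (subst suminf_geometric [symmetric], simp, intro sum_le_suminf) auto
  qed
  finally show ?thesis by simp
qed

lemma summable_exp_len:
  assumes "growth_at_most a A" "a < b" "A \<subseteq> carrier G"
  shows "(\<lambda>g. exp (- b * real (len g))) summable_on A"
proof -
  obtain C where C: "\<And>n. real (card {g \<in> A. len g \<le> n}) \<le> C * exp (a * real n)"
    using assms by (auto simp: growth_at_most_def)
  show ?thesis
    by (rule nonneg_bdd_above_summable_on)
       (auto intro!: bdd_aboveI2 [where M = "C / (1 - exp (a - b))"]
         sum_exp_len_le [OF C assms(2), simplified] assms)
qed

section \<open>Subgroup elements with a prescribed prefix\<close>

text \<open>
  If \<open>u\<close> and \<open>v\<close> start with different letters, then \<open>u\<^bsup>-1\<^esup>v\<close> is reduced as written, so the pair can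
  be read off from the product when the lengths are known.
\<close>

lemma pairs_with_distinct_heads_le:
  assumes A: "A \<subseteq> basis_words" "\<And>w. w \<in> A \<Longrightarrow> length w = l"
    and B: "B \<subseteq> basis_words" "\<And>w. w \<in> B \<Longrightarrow> length w = l"
    and heads: "\<And>u v. u \<in> A \<Longrightarrow> v \<in> B \<Longrightarrow> hd u \<noteq> hd v"
    and quot: "\<And>u v. u \<in> A \<Longrightarrow> v \<in> B \<Longrightarrow> inv (word_value G u) \<otimes> word_value G v \<in> K"
    and K: "K \<subseteq> carrier G"
  shows "card A * card B \<le> card {g \<in> K. len g \<le> 2 * l}"
proof -
  let ?f = "\<lambda>(u, v). word_value G (inverse_word u @ v)"
  have mem: "inverse_word u @ v \<in> basis_words" if "u \<in> A" "v \<in> B" for u v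
  proof -
    have "u \<in> basis_words" "v \<in> basis_words" "hd u \<noteq> hd v"
      using that A B heads by auto
    then show ?thesis
      using reduced_word_inverse_append [of u v] set_inverse_word [of u X]
      by (simp add: basis_words_def)
  qed
  have "card (A \<times> B) \<le> card {g \<in> K. len g \<le> 2 * l}"
  proof (rule card_inj_on_le [of ?f])
    show "inj_on ?f (A \<times> B)"
    proof (rule inj_onI, clarify)
      fix u v u' v' assume *: "u \<in> A" "v \<in> B" "u' \<in> A" "v' \<in> B"
        and "word_value G (inverse_word u @ v) = word_value G (inverse_word u' @ v')"
      then have "inverse_word u @ v = inverse_word u' @ v'"
        using normal_form_word_value mem by metis
      then have "inverse_word u = inverse_word u' \<and> v = v'"
        using * A(2) by simp
      then show "u = u' \<and> v = v'"
        using inj_inverse_word by (auto dest: injD)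
    qed
    show "?f ` (A \<times> B) \<subseteq> {g \<in> K. len g \<le> 2 * l}"
    proof clarify
      fix u v assume uv: "u \<in> A" "v \<in> B"
      then have sets: "set u \<subseteq> X \<times> UNIV" "set v \<subseteq> X \<times> UNIV"
        using A B by (auto simp: basis_words_def)
      then have "word_value G (inverse_word u @ v) = inv (word_value G u) \<otimes> word_value G v"
        using word_value_append word_value_inverse letters_in_carrier set_inverse_word by metis
      then show "word_value G (inverse_word u @ v) \<in> K \<and>
          len (word_value G (inverse_word u @ v)) \<le> 2 * l"
        using quot [OF uv] len_word_value [OF mem [OF uv]] uv A(2) B(2) by simp
    qed
  qed (rule finite_ball_inter [OF K])
  then show ?thesis
    by (simp add: card_cartesian_product)
qed

definition words_into :: "'a set \<Rightarrow> nat \<Rightarrow> ('a \<times> bool) list set" where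
  "words_into Q l = {w \<in> basis_words. length w = l \<and> word_value G w \<in> Q}"

lemma finite_words_into: "finite (words_into Q l)"
proof (rule finite_subset)
  show "finite {w. set w \<subseteq> X \<times> (UNIV :: bool set) \<and> length w = l}"
    using finite_basis by (intro finite_lists_length_eq) auto
qed (auto simp: words_into_def basis_words_def)

text \<open>
  Two elements \<open>u, v\<close> of length \<open>l\<close> of the coset yield an element \<open>u\<^bsup>-1\<^esup>v\<close> of \<open>K\<close> of length at most
  \<open>2l\<close>, which alone would only give the rate \<open>2s\<close>. To obtain the rate \<open>s\<close>, the elements are sorted
  by their first letter. If some class is larger than \<open>e\<^bsup>sl\<^esup>\<close>, then pairs of an element inside and
  one outside this class inject into \<open>K\<close>, so that at most \<open>C e\<^bsup>sl\<^esup>\<close> elements lie outside; the class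
  itself is, after its common letter is removed, a set of the same kind for \<open>l - 1\<close>. If there is no
  such class, the number of letters bounds the number of classes. The constant
  does not depend on the coset.
\<close>

lemma card_words_into_coset_le:
  assumes K: "K \<subseteq> carrier G" and "s \<ge> 0"
    and growth: "\<And>n. real (card {g \<in> K. len g \<le> n}) \<le> C * exp (s * real n)"
    and "Q \<subseteq> carrier G" and "\<And>a b. a \<in> Q \<Longrightarrow> b \<in> Q \<Longrightarrow> inv a \<otimes> b \<in> K"
  shows "real (card (words_into Q l)) \<le> (C + 2 * real (card X) + 1) * real (l + 1) * exp (s * real l)"
proof -
  let ?D = "C + 2 * real (card X) + 1"
  have C: "C \<ge> 0"
    using order_trans [OF _ growth [of 0]] by simp
  show ?thesis
    using assms(4,5)
  proof (induction l arbitrary: Q)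
    case 0
    have "words_into Q 0 \<subseteq> {[]}"
      by (auto simp: words_into_def)
    then have "card (words_into Q 0) \<le> 1"
      using card_mono [of "{[]}" "words_into Q 0"] by simp
    then show ?case
      using C by simp
  next
    case (Suc l)
    define W where "W = words_into Q (Suc l)"
    define V where "V a = {w \<in> W. hd w = a}" for a
    have finW: "finite W"
      by (simp add: W_def finite_words_into)
    have W: "w \<in> basis_words" "length w = Suc l" "word_value G w \<in> Q" "w \<noteq> []" if "w \<in> W" for w
      using that by (auto simp: W_def words_into_def)
    have split: "W = (\<Union>a\<in>X \<times> UNIV. V a)"
    proof -
      have "hd w \<in> X \<times> UNIV" if "w \<in> W" for w
        using W [OF that] hd_in_set [of w] by (auto simp: basis_words_def)
      then show ?thesis by (auto simp: V_def)
    qed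
    show ?case
    proof (cases "\<forall>a\<in>X \<times> UNIV. real (card (V a)) \<le> exp (s * real (Suc l))")
      case True
      have "card W \<le> (\<Sum>a\<in>X \<times> UNIV. card (V a))"
        unfolding split using finite_basis by (intro card_UN_le) auto
      then have "real (card W) \<le> (\<Sum>a\<in>X \<times> (UNIV :: bool set). real (card (V a)))"
        by (metis of_nat_mono of_nat_sum)
      also have "\<dots> \<le> (\<Sum>a\<in>X \<times> (UNIV :: bool set). exp (s * real (Suc l)))"
        using True by (intro sum_mono) auto
      also have "\<dots> = 2 * real (card X) * 1 * exp (s * real (Suc l))"
        by (simp add: card_cartesian_product)
      also have "\<dots> \<le> ?D * real (Suc l + 1) * exp (s * real (Suc l))"
        using C by (intro mult_right_mono mult_mono) auto
      finally show ?thesis by (simp add: W_def)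
    next
      case False
      then obtain a where a: "a \<in> X \<times> UNIV" and big: "real (card (V a)) > exp (s * real (Suc l))"
        by (meson not_le)
      have lv: "letter_value G a \<in> carrier G"
        using a basis_subset by (auto intro!: letter_value_closed)
      \<comment> \<open>stripping the common first letter moves the coset\<close>
      have "card (V a) \<le> card (words_into ((\<lambda>g. inv (letter_value G a) \<otimes> g) ` Q) l)"
      proof (rule card_inj_on_le [of tl])
        show "inj_on tl (V a)"
          using W by (auto simp: V_def inj_on_def) (metis list.collapse)
        show "tl ` V a \<subseteq> words_into ((\<lambda>g. inv (letter_value G a) \<otimes> g) ` Q) l"
        proof
          fix u assume "u \<in> tl ` V a"
          then have w: "a # u \<in> W"
            using W by (auto simp: V_def) 
          have u: "u \<in> basis_words"
            using W(1) [OF w] by (auto simp: basis_words_def reduced_word_def successively_Cons)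
          have "word_value G u = inv (letter_value G a) \<otimes> word_value G (a # u)"
            using lv word_value_in_carrier [of u] u
            by (simp add: basis_words_def m_assoc [symmetric])
          then show "u \<in> words_into ((\<lambda>g. inv (letter_value G a) \<otimes> g) ` Q) l"
            using W [OF w] u by (auto simp: words_into_def)
        qed
      qed (rule finite_words_into)
      also have "real (card (words_into ((\<lambda>g. inv (letter_value G a) \<otimes> g) ` Q) l)) \<le>
          ?D * real (l + 1) * exp (s * real l)"
      proof (rule Suc.IH)
        show "(\<lambda>g. inv (letter_value G a) \<otimes> g) ` Q \<subseteq> carrier G"
          using Suc.prems(1) lv by auto
        fix x y assume "x \<in> (\<lambda>g. inv (letter_value G a) \<otimes> g) ` Q"
          "y \<in> (\<lambda>g. inv (letter_value G a) \<otimes> g) ` Q"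
        then obtain g h where gh: "g \<in> Q" "h \<in> Q" "x = inv (letter_value G a) \<otimes> g"
          "y = inv (letter_value G a) \<otimes> h" by auto
        have "g \<in> carrier G" "h \<in> carrier G"
          using gh Suc.prems(1) by auto
        then have "inv x \<otimes> y = inv g \<otimes> ((letter_value G a \<otimes> inv (letter_value G a)) \<otimes> h)"
          using gh lv by (simp only: inv_mult_group inv_inv inv_closed m_assoc m_closed)
        then show "inv x \<otimes> y \<in> K"
          using gh Suc.prems lv \<open>h \<in> carrier G\<close> by simp
      qed
      also have "?D * real (l + 1) * exp (s * real l) \<le> ?D * real (l + 1) * exp (s * real (Suc l))"
        using C \<open>s \<ge> 0\<close> by (intro mult_left_mono) (auto intro: mult_left_mono)
      finally have M: "real (card (V a)) \<le> ?D * real (l + 1) * exp (s * real (Suc l))"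
        by simp
      have "card (V a) * card (W - V a) \<le> card {g \<in> K. len g \<le> 2 * Suc l}"
      proof (rule pairs_with_distinct_heads_le [OF _ _ _ _ _ _ K])
        show "inv (word_value G u) \<otimes> word_value G v \<in> K" if "u \<in> V a" "v \<in> W - V a" for u v
          using that W Suc.prems(2) by (auto simp: V_def)
      qed (auto simp: V_def W)
      then have "real (card (V a) * card (W - V a)) \<le> real (card {g \<in> K. len g \<le> 2 * Suc l})"
        by (rule of_nat_mono)
      also have "\<dots> \<le> C * exp (s * real (2 * Suc l))"
        by (rule growth)
      also have "\<dots> = exp (s * real (Suc l)) * (C * exp (s * real (Suc l)))"
        by (simp add: exp_add [symmetric] algebra_simps mult_exp_exp)
      finally have prod: "real (card (V a)) * real (card (W - V a)) \<le>
          exp (s * real (Suc l)) * (C * exp (s * real (Suc l)))"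
        by (simp only: of_nat_mult)
      have "exp (s * real (Suc l)) * real (card (W - V a)) \<le>
          exp (s * real (Suc l)) * (C * exp (s * real (Suc l)))"
        by (rule order_trans [OF mult_right_mono prod]) (use big in auto)
      then have R: "real (card (W - V a)) \<le> C * exp (s * real (Suc l))"
        by simp
      have "card W = card (V a) + card (W - V a)"
        using finW by (subst card_Un_disjoint [symmetric]) (auto simp: V_def intro: arg_cong [where f = card])
      then have "real (card W) \<le> ?D * real (l + 1) * exp (s * real (Suc l)) + C * exp (s * real (Suc l))"
        using M R by simp
      also have "\<dots> \<le> ?D * real (l + 1) * exp (s * real (Suc l)) + ?D * exp (s * real (Suc l))"
        by (intro add_left_mono mult_right_mono) auto
      also have "\<dots> = ?D * real (Suc l + 1) * exp (s * real (Suc l))"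
        by (simp add: algebra_simps)
      finally show ?thesis by (simp add: W_def)
    qed
  qed
qed

section \<open>Averaging exponential weights over a sphere of a subgroup\<close>

definition word_sphere :: "'a set \<Rightarrow> nat \<Rightarrow> 'a set" where
  "word_sphere K n = {z \<in> K. len z = n}"

lemma finite_word_sphere: "K \<subseteq> carrier G \<Longrightarrow> finite (word_sphere K n)"
  using finite_ball_inter [of K n] by (rule rev_finite_subset) (auto simp: word_sphere_def)

text \<open>
  The elements \<open>p q\<close> of \<open>K\<close> with a fixed prefix \<open>p\<close> correspond to the elements \<open>q\<close> of the coset
  \<open>p\<^bsup>-1\<^esup>K\<close>.
\<close>

lemma card_sphere_prefix_le:
  assumes K: "subgroup K G" and "s \<ge> 0"
    and growth: "\<And>n. real (card {g \<in> K. len g \<le> n}) \<le> C * exp (s * real n)"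
    and "t \<le> n"
  shows "real (card {z \<in> word_sphere K n. take t (normal_form z) = p}) \<le>
    (C + 2 * real (card X) + 1) * real (n + 1) * exp (s * real (n - t))"
proof (cases "set p \<subseteq> X \<times> UNIV")
  case False
  have "{z \<in> word_sphere K n. take t (normal_form z) = p} = {}"
  proof -
    have "set (take t (normal_form z)) \<subseteq> X \<times> UNIV" if "z \<in> word_sphere K n" for z
      using that normal_form_in [of z] subgroup.mem_carrier [OF K] set_take_subset [of t "normal_form z"]
      by (auto simp: basis_words_def word_sphere_def)
    with False show ?thesis by blast
  qed
  moreover have "C \<ge> 0"
    using order_trans [OF _ growth [of 0]] by simp
  ultimately show ?thesis by (simp del: Collect_empty_eq)
next
  case True
  interpret K: subgroup K G by fact
  let ?p = "word_value G p"
  let ?Q = "(\<lambda>k. inv ?p \<otimes> k) ` K"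
  have p: "?p \<in> carrier G"
    using True by (rule word_value_in_carrier)
  have C: "C \<ge> 0"
    using order_trans [OF _ growth [of 0]] by simp
  have "card {z \<in> word_sphere K n. take t (normal_form z) = p} \<le> card (words_into ?Q (n - t))"
  proof (rule card_inj_on_le [of "\<lambda>z. drop t (normal_form z)"])
    show "inj_on (\<lambda>z. drop t (normal_form z)) {z \<in> word_sphere K n. take t (normal_form z) = p}"
    proof (rule inj_onI, clarify)
      fix z z' assume *: "z \<in> word_sphere K n" "z' \<in> word_sphere K n" "p = take t (normal_form z)"
        "take t (normal_form z') = take t (normal_form z)"
        "drop t (normal_form z) = drop t (normal_form z')"
      then have "normal_form z = normal_form z'"
        by (metis append_take_drop_id)
      then show "z = z'"
        using * word_value_normal_form K.mem_carrier unfolding word_sphere_def by (metis mem_Collect_eq)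
    qed
    show "(\<lambda>z. drop t (normal_form z)) ` {z \<in> word_sphere K n. take t (normal_form z) = p}
        \<subseteq> words_into ?Q (n - t)"
    proof (rule image_subsetI)
      fix z assume "z \<in> {z \<in> word_sphere K n. take t (normal_form z) = p}"
      then have z: "z \<in> word_sphere K n" and pz: "p = take t (normal_form z)"
        by auto
      let ?u = "drop t (normal_form z)"
      have zK: "z \<in> K" and nz: "p @ ?u = normal_form z"
        using z pz by (auto simp: word_sphere_def)
      have mem: "p @ ?u \<in> basis_words"
        using nz normal_form_in zK by simp
      then have u: "?u \<in> basis_words"
        by (auto simp: basis_words_def reduced_word_def successively_append_iff)
      have "set ?u \<subseteq> X \<times> UNIV"
        using u by (simp add: basis_words_def)
      then have "word_value G (p @ ?u) = ?p \<otimes> word_value G ?u"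
        using True by (intro word_value_append letters_in_carrier)
      then have "z = ?p \<otimes> word_value G ?u"
        using nz word_value_normal_form [of z] zK by simp
      then have "word_value G ?u = inv ?p \<otimes> z"
        using p u word_value_in_carrier [of ?u] zK by (simp add: basis_words_def inv_solve_left)
      moreover have "length ?u = n - t"
        using z zK by (simp add: word_sphere_def len_eq_length)
      ultimately show "?u \<in> words_into ?Q (n - t)"
        using u zK by (auto simp: words_into_def)
    qed
  qed (rule finite_words_into)
  also have "real (card (words_into ?Q (n - t))) \<le>
      (C + 2 * real (card X) + 1) * real (n - t + 1) * exp (s * real (n - t))"
  proof (rule card_words_into_coset_le [OF K.subset \<open>s \<ge> 0\<close> growth])
    show "?Q \<subseteq> carrier G"
      using p by auto
    fix x y assume "x \<in> ?Q" "y \<in> ?Q"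
    then obtain g h where gh: "g \<in> K" "h \<in> K" "x = inv ?p \<otimes> g" "y = inv ?p \<otimes> h"
      by auto
    then have "inv x \<otimes> y = inv g \<otimes> ((?p \<otimes> inv ?p) \<otimes> h)"
      using p by (simp only: inv_mult_group inv_inv inv_closed m_assoc m_closed K.mem_carrier)
    then show "inv x \<otimes> y \<in> K"
      using gh p by simp
  qed
  also have "\<dots> \<le> (C + 2 * real (card X) + 1) * real (n + 1) * exp (s * real (n - t))"
    using C by (intro mult_right_mono mult_left_mono) auto
  finally show ?thesis by simp
qed

text \<open>
  If \<open>z\<close> and \<open>g\<close> share a prefix of length \<open>t\<close>, then the summand is \<open>e\<^bsup>2bt\<^esup>\<close> times the fixed factor
  \<open>e\<^bsup>-b(n + |g|)\<^esup>\<close>, and there are at most about \<open>e\<^bsup>2b(n - t)\<^esup>\<close> such \<open>z\<close>. The rate \<open>2b\<close> for \<open>K\<close> is chosen so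
  that all \<open>t\<close> contribute equally, which costs only a polynomial factor.
\<close>

lemma sum_sphere_exp_len_le:
  assumes K: "subgroup K G" and "b \<ge> 0"
    and growth: "\<And>n. real (card {g \<in> K. len g \<le> n}) \<le> C * exp (2 * b * real n)"
    and g: "g \<in> carrier G"
  shows "(\<Sum>z\<in>word_sphere K n. exp (- b * real (len (inv z \<otimes> g)))) \<le>
    (C + 2 * real (card X) + 1) * real (n + 1) ^ 2 * exp (b * real n) * exp (- b * real (len g))"
proof -
  let ?D = "C + 2 * real (card X) + 1"
  let ?P = "\<lambda>t. {z \<in> word_sphere K n. take t (normal_form z) = take t (normal_form g)}"
  let ?E = "exp (- b * (real n + real (len g)))"
  have KG: "K \<subseteq> carrier G"
    using K by (rule subgroup.subset)
  have fin: "finite (word_sphere K n)"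
    using KG by (rule finite_word_sphere)
  have "(\<Sum>z\<in>word_sphere K n. exp (- b * real (len (inv z \<otimes> g)))) \<le>
      (\<Sum>z\<in>word_sphere K n. \<Sum>t\<le>n. ?E * (exp (2 * b * real t) * of_bool (z \<in> ?P t)))"
  proof (rule sum_mono)
    fix z assume z: "z \<in> word_sphere K n"
    then have zG: "z \<in> carrier G" and lz: "len z = n"
      using KG by (auto simp: word_sphere_def)
    obtain t where t: "t \<le> len z" "take t (normal_form z) = take t (normal_form g)"
      "len (inv z \<otimes> g) + 2 * t = len z + len g"
      using len_inv_mult_eq [OF zG g] by metis
    have len: "real (len (inv z \<otimes> g)) = real n + real (len g) - 2 * real t"
      using t(3) lz by linarith
    have "exp (- b * real (len (inv z \<otimes> g))) = ?E * (exp (2 * b * real t) * of_bool (z \<in> ?P t))"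
      unfolding len using z t(2) by (simp add: exp_add [symmetric] algebra_simps mult_exp_exp)
    also have "\<dots> \<le> (\<Sum>t\<le>n. ?E * (exp (2 * b * real t) * of_bool (z \<in> ?P t)))"
      using t(1) lz by (intro member_le_sum) auto
    finally show "exp (- b * real (len (inv z \<otimes> g))) \<le>
      (\<Sum>t\<le>n. ?E * (exp (2 * b * real t) * of_bool (z \<in> ?P t)))" .
  qed
  also have "\<dots> = (\<Sum>t\<le>n. \<Sum>z\<in>word_sphere K n. ?E * (exp (2 * b * real t) * of_bool (z \<in> ?P t)))"
    by (rule sum.swap)
  also have "\<dots> = (\<Sum>t\<le>n. ?E * (exp (2 * b * real t) * real (card (?P t))))"
    using fin by (simp add: sum_distrib_left [symmetric] of_bool_def sum.If_cases Int_def conj_commute)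
  also have "\<dots> \<le> (\<Sum>t\<le>n. ?E * (?D * real (n + 1) * exp (2 * b * real n)))"
  proof (intro sum_mono mult_left_mono)
    fix t assume "t \<in> {..n}"
    then have t: "t \<le> n" by simp
    have "exp (2 * b * real t) * real (card (?P t)) \<le>
        exp (2 * b * real t) * (?D * real (n + 1) * exp (2 * b * real (n - t)))"
      using card_sphere_prefix_le [OF K _ growth t] \<open>b \<ge> 0\<close> by (intro mult_left_mono) auto
    also have "\<dots> = ?D * real (n + 1) * exp (2 * b * real n)"
      using t by (simp add: of_nat_diff mult_exp_exp algebra_simps)
    finally show "exp (2 * b * real t) * real (card (?P t)) \<le> ?D * real (n + 1) * exp (2 * b * real n)" .
  qed auto
  also have "\<dots> = ?D * real (n + 1) ^ 2 * (?E * exp (2 * b * real n))"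
    by (simp add: power2_eq_square algebra_simps)
  also have "?E * exp (2 * b * real n) = exp (b * real n) * exp (- b * real (len g))"
    by (simp add: mult_exp_exp algebra_simps)
  finally show ?thesis
    by (simp add: mult.assoc)
qed

end

section \<open>A Schur test for group actions\<close>

text \<open>
  A positive \<open>v\<close> with \<open>A v \<le> c v\<close> bounds the quadratic form of the symmetric operator
  \<open>A = (\<Sum>z. act z)\<close> by \<open>c\<close>: apply \<open>2xy \<le> r x\<^sup>2 + y\<^sup>2 / r\<close> with \<open>r\<close> the ratio of the values of
  \<open>v\<close>. The domain \<open>D\<close> may be infinite; only the vector is finitely supported.
\<close>

lemma schur_test:
  fixes act :: "'z \<Rightarrow> 'c \<Rightarrow> 'c" and \<phi> v :: "'c \<Rightarrow> real"
  assumes "finite F"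
    and iv: "\<And>z. z \<in> Z \<Longrightarrow> iv z \<in> Z" "\<And>z. z \<in> Z \<Longrightarrow> iv (iv z) = z"
    and D: "\<And>z x. z \<in> Z \<Longrightarrow> x \<in> D \<Longrightarrow> act z x \<in> D"
      "\<And>z x. z \<in> Z \<Longrightarrow> x \<in> D \<Longrightarrow> act (iv z) (act z x) = x"
    and v: "\<And>x. x \<in> D \<Longrightarrow> v x > 0" "\<And>x. x \<in> D \<Longrightarrow> (\<Sum>z\<in>Z. v (act z x)) \<le> c * v x"
    and supp: "\<And>x. x \<notin> F \<Longrightarrow> \<phi> x = 0"
  shows "(\<Sum>z\<in>Z. \<Sum>x\<in>F \<inter> D. \<phi> x * \<phi> (act z x)) \<le> c * (\<Sum>x\<in>F \<inter> D. (\<phi> x)\<^sup>2)"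
proof -
  let ?E = "F \<inter> D"
  define h where "h z x = (\<phi> x)\<^sup>2 * (v (act z x) / v x)" for z x
  have finE: "finite ?E"
    using \<open>finite F\<close> by simp
  have h_nonneg: "h z x \<ge> 0" if "z \<in> Z" "x \<in> D" for z x
  proof -
    have "v x > 0" "v (act z x) > 0"
      using v(1) D(1) that by blast+
    then show ?thesis by (simp add: h_def)
  qed
  have pointwise: "2 * (\<phi> x * \<phi> (act z x)) \<le> h z x + h (iv z) (act z x)"
    if z: "z \<in> Z" and x: "x \<in> D" for z x
  proof -
    define r where "r = v (act z x) / v x"
    have r: "r > 0"
      using v(1) D(1) x z by (simp add: r_def)
    have "0 \<le> (\<phi> x * r - \<phi> (act z x))\<^sup>2 / r"
      using r by simp
    also have "\<dots> = (\<phi> x)\<^sup>2 * r + (\<phi> (act z x))\<^sup>2 / r - 2 * (\<phi> x * \<phi> (act z x))"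
      using r by (simp add: power2_eq_square field_simps)
    finally show ?thesis
      using D(2) [OF z x] by (simp add: h_def r_def)
  qed
  have moved: "(\<Sum>x\<in>?E. h (iv z) (act z x)) \<le> (\<Sum>x\<in>?E. h (iv z) x)" if z: "z \<in> Z" for z
  proof -
    have "inj_on (act z) ?E"
      by (rule inj_on_inverseI [of _ "act (iv z)"]) (use D(2) z in auto)
    then have "(\<Sum>x\<in>?E. h (iv z) (act z x)) = (\<Sum>y\<in>act z ` ?E. h (iv z) y)"
      by (simp add: sum.reindex)
    also have "\<dots> = (\<Sum>y\<in>act z ` ?E \<inter> F. h (iv z) y)"
      using finE supp by (intro sum.mono_neutral_right) (auto simp: h_def)
    also have "\<dots> \<le> (\<Sum>x\<in>?E. h (iv z) x)"
      using finE D(1) z iv(1) h_nonneg by (intro sum_mono2) auto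
    finally show ?thesis .
  qed
  have "2 * (\<Sum>z\<in>Z. \<Sum>x\<in>?E. \<phi> x * \<phi> (act z x)) =
      (\<Sum>z\<in>Z. \<Sum>x\<in>?E. 2 * (\<phi> x * \<phi> (act z x)))"
    by (simp add: sum_distrib_left)
  also have "\<dots> \<le> (\<Sum>z\<in>Z. \<Sum>x\<in>?E. h z x + h (iv z) (act z x))"
    using pointwise by (intro sum_mono) auto
  also have "\<dots> \<le> (\<Sum>z\<in>Z. \<Sum>x\<in>?E. h z x) + (\<Sum>z\<in>Z. \<Sum>x\<in>?E. h (iv z) x)"
    by (simp add: sum.distrib sum_mono moved)
  also have "(\<Sum>z\<in>Z. \<Sum>x\<in>?E. h (iv z) x) = (\<Sum>z\<in>Z. \<Sum>x\<in>?E. h z x)"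
    using iv by (intro sum.reindex_bij_witness [of _ iv iv]) auto
  also have "(\<Sum>z\<in>Z. \<Sum>x\<in>?E. h z x) = (\<Sum>x\<in>?E. (\<phi> x)\<^sup>2 / v x * (\<Sum>z\<in>Z. v (act z x)))"
    by (subst sum.swap) (simp add: h_def sum_distrib_left)
  also have "\<dots> \<le> (\<Sum>x\<in>?E. c * (\<phi> x)\<^sup>2)"
  proof (rule sum_mono)
    fix x assume x: "x \<in> ?E"
    then have "(\<phi> x)\<^sup>2 / v x * (\<Sum>z\<in>Z. v (act z x)) \<le> (\<phi> x)\<^sup>2 / v x * (c * v x)"
      using v by (intro mult_left_mono) (auto intro!: divide_nonneg_pos)
    also have "\<dots> = c * (\<phi> x)\<^sup>2"
      using v(1) [of x] x by simp
    finally show "(\<phi> x)\<^sup>2 / v x * (\<Sum>z\<in>Z. v (act z x)) \<le> c * (\<phi> x)\<^sup>2" .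
  qed
  also have "(\<Sum>x\<in>?E. c * (\<phi> x)\<^sup>2) = c * (\<Sum>x\<in>?E. (\<phi> x)\<^sup>2)"
    by (simp add: sum_distrib_left)
  finally show ?thesis
    by linarith
qed

section \<open>The action of a subgroup on cosets of small stabilizer\<close>

lemma (in group) lcosets_translate:
  assumes "subgroup H G" "C \<in> lcosets H"
  shows lcoset_subset: "C \<subseteq> carrier G"
    and lcoset_translate: "z \<in> carrier G \<Longrightarrow> z <# C \<in> lcosets H"
proof -
  obtain a where a: "a \<in> carrier G" "C = a <# H"
    using assms(2) by (auto simp: LCOSETS_def)
  then show "C \<subseteq> carrier G"
    using l_coset_subset_G subgroup.subset [OF assms(1)] by simp
  show "z <# C \<in> lcosets H" if "z \<in> carrier G"
    using a that lcos_m_assoc [OF subgroup.subset [OF assms(1)]] by (auto simp: LCOSETS_def)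
qed

lemma infsum_sum_swap:
  fixes f :: "'i \<Rightarrow> 'b \<Rightarrow> real"
  assumes "finite I" "\<And>i. i \<in> I \<Longrightarrow> f i summable_on A"
  shows "(\<lambda>x. \<Sum>i\<in>I. f i x) summable_on A"
    and "infsum (\<lambda>x. \<Sum>i\<in>I. f i x) A = (\<Sum>i\<in>I. infsum (f i) A)"
  using assms
  by (induction I rule: finite_induct) (auto simp: summable_on_add infsum_add)

context finitely_generated_free_group
begin

definition coset_stabilizer :: "'a set \<Rightarrow> 'a set \<Rightarrow> 'a set" where
  "coset_stabilizer K C = {k \<in> K. k <# C = C}"

definition small_stabilizer_cosets :: "real \<Rightarrow> 'a set \<Rightarrow> 'a set \<Rightarrow> 'a set set" where
  "small_stabilizer_cosets a K H = {C \<in> lcosets H. growth_at_most a (coset_stabilizer K C)}"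

text \<open>
  The stabilizers along an orbit of \<open>K\<close> are conjugate by elements of \<open>K\<close>.
\<close>

lemma small_stabilizer_cosets_invariant:
  assumes K: "subgroup K G" and H: "subgroup H G" and "a \<ge> 0"
    and C: "C \<in> small_stabilizer_cosets a K H" and z: "z \<in> K"
  shows "z <# C \<in> small_stabilizer_cosets a K H"
proof -
  interpret K: subgroup K G by fact
  have CH: "C \<in> lcosets H" and growth: "growth_at_most a (coset_stabilizer K C)"
    using C by (auto simp: small_stabilizer_cosets_def)
  have CG: "C \<subseteq> carrier G"
    using lcoset_subset [OF H CH] .
  have zG: "z \<in> carrier G"
    using z by simp
  let ?f = "\<lambda>k. inv z \<otimes> k \<otimes> z"
  have "growth_at_most a (coset_stabilizer K (z <# C))"
  proof (rule growth_at_most_transfer [OF growth \<open>a \<ge> 0\<close>])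
    show "coset_stabilizer K C \<subseteq> carrier G"
      using K.subset by (auto simp: coset_stabilizer_def)
    show "inj_on ?f (coset_stabilizer K (z <# C))"
      using z by (auto simp: inj_on_def coset_stabilizer_def)
    show "?f ` coset_stabilizer K (z <# C) \<subseteq> coset_stabilizer K C"
    proof clarify
      fix k assume "k \<in> coset_stabilizer K (z <# C)"
      then have k: "k \<in> K" and stab: "k <# (z <# C) = z <# C"
        by (auto simp: coset_stabilizer_def)
      have "?f k <# C = inv z <# (k <# (z <# C))"
        using k z CG by (simp add: lcos_m_assoc m_assoc l_coset_subset_G)
      also have "\<dots> = C"
        using z CG by (simp add: stab) (simp add: lcos_m_assoc lcos_mult_one)
      finally show "?f k \<in> coset_stabilizer K C"
        using k z by (simp add: coset_stabilizer_def)
    qed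
    show "len (?f k) \<le> len k + (len (inv z) + len z)" if "k \<in> coset_stabilizer K (z <# C)" for k
    proof -
      have "k \<in> carrier G"
        using that by (auto simp: coset_stabilizer_def)
      then show ?thesis
        using len_mult_le [of "inv z \<otimes> k" z] len_mult_le [of "inv z" k] zG by simp
    qed
  qed
  then show ?thesis
    using lcoset_translate [OF H CH zG] by (simp add: small_stabilizer_cosets_def)
qed

text \<open>
  The function \<open>v C\<close> is the sum of \<open>e\<^bsup>-b|k|\<^esup>\<close> over all \<open>k \<in> K\<close> that carry a base point of the orbit
  to \<open>C\<close>. These \<open>k\<close> form a coset of a stabilizer, so the series converges on cosets of small
  stabilizer. Translating \<open>C\<close> by \<open>z\<close> translates the index set, and the inequality then holds
  summand by summand by \<open>sum_sphere_exp_len_le\<close>.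
\<close>

lemma orbit_weight:
  assumes K: "subgroup K G" and H: "subgroup H G" and "0 \<le> a" "a < b"
    and growth: "\<And>n. real (card {g \<in> K. len g \<le> n}) \<le> C0 * exp (2 * b * real n)"
  obtains v :: "'a set \<Rightarrow> real"
  where "\<And>C. C \<in> small_stabilizer_cosets a K H \<Longrightarrow> v C > 0"
    and "\<And>C n. C \<in> small_stabilizer_cosets a K H \<Longrightarrow> (\<Sum>z\<in>word_sphere K n. v (z <# C)) \<le>
      (C0 + 2 * real (card X) + 1) * real (n + 1) ^ 2 * exp (b * real n) * v C"
proof -
  interpret K: subgroup K G by fact
  define base where "base C = (SOME B. B \<in> (\<lambda>k. k <# C) ` K)" for C
  define T where "T C = {k \<in> K. k <# base C = C}" for C
  define e where "e g = exp (- b * real (len g))" for g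
  define v where "v C = infsum e (T C)" for C
  have CG: "C \<subseteq> carrier G" if "C \<in> small_stabilizer_cosets a K H" for C
    using that lcoset_subset [OF H] by (simp add: small_stabilizer_cosets_def)
  have "\<exists>k\<in>K. base C = k <# C" for C
  proof -
    have "base C \<in> (\<lambda>k. k <# C) ` K"
      unfolding base_def by (rule someI [of _ "\<one> <# C"]) auto
    then show ?thesis by blast
  qed
  then obtain g where "\<And>C. g C \<in> K \<and> base C = g C <# C"
    by metis
  then have gK: "g C \<in> K" and g: "base C = g C <# C" for C
    by auto
  have base_G: "base C \<subseteq> carrier G" if "C \<subseteq> carrier G" for C
    using g gK that by (simp add: l_coset_subset_G)
  have inv_g: "inv (g C) \<in> T C" if "C \<subseteq> carrier G" for C
    using gK that by (simp add: T_def g lcos_m_assoc lcos_mult_one)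
  have T_sub: "T C \<subseteq> carrier G" for C
    by (auto simp: T_def)
  have summable: "e summable_on T C" if C: "C \<in> small_stabilizer_cosets a K H" for C
  proof -
    have "growth_at_most a (T C)"
    proof (rule growth_at_most_transfer [of _ "coset_stabilizer K C"])
      show "growth_at_most a (coset_stabilizer K C)"
        using C by (simp add: small_stabilizer_cosets_def)
      show "coset_stabilizer K C \<subseteq> carrier G"
        by (auto simp: coset_stabilizer_def)
      show "inj_on (\<lambda>h. h \<otimes> g C) (T C)"
        using gK by (auto simp: inj_on_def T_def)
      show "(\<lambda>h. h \<otimes> g C) ` T C \<subseteq> coset_stabilizer K C"
        using gK CG [OF C] by (auto simp: T_def coset_stabilizer_def g lcos_m_assoc [symmetric])
      show "len (h \<otimes> g C) \<le> len h + len (g C)" if "h \<in> T C" for h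
        using that gK by (intro len_mult_le) (auto simp: T_def)
    qed fact
    then show ?thesis
      unfolding e_def [abs_def] using \<open>a < b\<close> T_sub by (rule summable_exp_len)
  qed
  have base_translate: "base (z <# C) = base C" if z: "z \<in> K" and C: "C \<subseteq> carrier G" for z C
  proof -
    have "(\<lambda>k. k <# (z <# C)) ` K = (\<lambda>k. k <# C) ` K"
    proof
      show "(\<lambda>k. k <# (z <# C)) ` K \<subseteq> (\<lambda>k. k <# C) ` K"
        using z C by (auto simp: lcos_m_assoc)
      show "(\<lambda>k. k <# C) ` K \<subseteq> (\<lambda>k. k <# (z <# C)) ` K"
      proof clarify
        fix k assume "k \<in> K"
        then show "k <# C \<in> (\<lambda>k. k <# (z <# C)) ` K"
          using z C by (intro image_eqI [of _ _ "k \<otimes> inv z"]) (auto simp: lcos_m_assoc m_assoc)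
      qed
    qed
    then show ?thesis by (simp add: base_def)
  qed
  have T_translate: "T (z <# C) = (\<lambda>k. z \<otimes> k) ` T C" if z: "z \<in> K" and C: "C \<subseteq> carrier G" for z C
  proof
    show "(\<lambda>k. z \<otimes> k) ` T C \<subseteq> T (z <# C)"
      using z base_translate [OF z C] base_G [OF C]
      by (auto simp: T_def lcos_m_assoc [symmetric])
    show "T (z <# C) \<subseteq> (\<lambda>k. z \<otimes> k) ` T C"
    proof
      fix k assume "k \<in> T (z <# C)"
      then have k: "k \<in> K" "k <# base C = z <# C"
        using base_translate [OF z C] by (auto simp: T_def)
      have "(inv z \<otimes> k) <# base C = inv z <# (z <# C)"
        using k z base_G [OF C] by (simp add: lcos_m_assoc [symmetric])
      also have "\<dots> = C"
        using z C by (simp add: lcos_m_assoc lcos_mult_one)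
      finally have "inv z \<otimes> k \<in> T C"
        using k z by (simp add: T_def)
      then show "k \<in> (\<lambda>k. z \<otimes> k) ` T C"
        using k z by (intro image_eqI [of _ _ "inv z \<otimes> k"]) (auto simp: m_assoc [symmetric])
    qed
  qed
  show thesis
  proof (rule that [of v])
    fix C assume C: "C \<in> small_stabilizer_cosets a K H"
    have "0 < sum e {inv (g C)}"
      by (simp add: e_def)
    also have "\<dots> \<le> v C"
      unfolding v_def using summable [OF C] inv_g [OF CG [OF C]]
      by (intro finite_sum_le_infsum) (auto simp: e_def)
    finally show "v C > 0" .
    fix n
    let ?Z = "word_sphere K n"
    let ?c = "(C0 + 2 * real (card X) + 1) * real (n + 1) ^ 2 * exp (b * real n)"
    have fin: "finite ?Z"
      using K.subset by (rule finite_word_sphere)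
    have Z: "z \<in> K" if "z \<in> ?Z" for z
      using that by (simp add: word_sphere_def)
    have inj: "inj_on (\<lambda>k. z \<otimes> k) (T C)" if "z \<in> K" for z
      using that by (auto simp: inj_on_def T_def)
    have summ: "(\<lambda>k. e (z \<otimes> k)) summable_on T C" if z: "z \<in> ?Z" for z
    proof -
      have "z <# C \<in> small_stabilizer_cosets a K H"
        using small_stabilizer_cosets_invariant [OF K H \<open>0 \<le> a\<close> C Z [OF z]] .
      then show ?thesis
        using summable [of "z <# C"]
        unfolding T_translate [OF Z [OF z] CG [OF C]] summable_on_reindex [OF inj [OF Z [OF z]]]
        by (simp add: comp_def)
    qed
    have "(\<Sum>z\<in>?Z. v (z <# C)) = (\<Sum>z\<in>?Z. infsum (\<lambda>k. e (z \<otimes> k)) (T C))"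
    proof (rule sum.cong)
      fix z assume z: "z \<in> ?Z"
      show "v (z <# C) = infsum (\<lambda>k. e (z \<otimes> k)) (T C)"
        unfolding v_def T_translate [OF Z [OF z] CG [OF C]] infsum_reindex [OF inj [OF Z [OF z]]]
        by (simp add: comp_def)
    qed simp
    also have "\<dots> = infsum (\<lambda>k. \<Sum>z\<in>?Z. e (z \<otimes> k)) (T C)"
      using infsum_sum_swap [OF fin summ] by simp
    also have "\<dots> \<le> infsum (\<lambda>k. ?c * e k) (T C)"
    proof (rule infsum_mono)
      show "(\<lambda>k. \<Sum>z\<in>?Z. e (z \<otimes> k)) summable_on T C"
        by (rule infsum_sum_swap [OF fin summ])
      show "(\<lambda>k. ?c * e k) summable_on T C"
        by (intro summable_on_cmult_right summable [OF C])
      fix k assume "k \<in> T C"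
      then have k: "k \<in> carrier G"
        using T_sub by auto
      have "(\<Sum>z\<in>?Z. e (z \<otimes> k)) = (\<Sum>z\<in>?Z. e (inv z \<otimes> k))"
        by (rule sum.reindex_bij_witness [of _ "m_inv G" "m_inv G"])
           (auto simp: word_sphere_def len_inv)
      also have "\<dots> \<le> ?c * e k"
        using sum_sphere_exp_len_le [OF K _ growth k, of n] \<open>0 \<le> a\<close> \<open>a < b\<close>
        by (simp add: e_def)
      finally show "(\<Sum>z\<in>?Z. e (z \<otimes> k)) \<le> ?c * e k" .
    qed
    also have "\<dots> = ?c * v C"
      unfolding v_def by (intro infsum_cmult_right summable [OF C])
    finally show "(\<Sum>z\<in>?Z. v (z <# C)) \<le> ?c * v C" .
  qed
qed

text \<open>
  Otherwise all spheres, and hence all balls, of \<open>K\<close> would be of size at most a polynomial times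
  \<open>e\<^bsup>bn\<^esup>\<close>.
\<close>

lemma exists_rich_sphere:
  assumes "\<not> growth_at_most b' K" "b < b'" "b \<ge> 0" "K \<subseteq> carrier G" "D > 0"
  obtains n where "2 * (D * real (n + 1) ^ 2 * exp (b * real n)) \<le> real (card (word_sphere K n))"
proof (rule ccontr)
  assume "\<not> thesis"
  then have small: "real (card (word_sphere K n)) \<le> 2 * (D * real (n + 1) ^ 2 * exp (b * real n))" for n
    using that [of n] by linarith
  define \<epsilon> where "\<epsilon> = b' - b"
  have eps: "\<epsilon> > 0"
    using assms by (simp add: \<epsilon>_def)
  have "real (card {g \<in> K. len g \<le> n}) \<le> (2 * D * (3 / \<epsilon>) ^ 3 * exp \<epsilon>) * exp (b' * real n)" for n
  proof -
    have "{g \<in> K. len g \<le> n} = (\<Union>i\<le>n. word_sphere K i)"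
      by (auto simp: word_sphere_def)
    then have "card {g \<in> K. len g \<le> n} \<le> (\<Sum>i\<le>n. card (word_sphere K i))"
      using card_UN_le [of "{..n}" "word_sphere K"] by simp
    then have "real (card {g \<in> K. len g \<le> n}) \<le> (\<Sum>i\<le>n. real (card (word_sphere K i)))"
      by (metis of_nat_mono of_nat_sum)
    also have "\<dots> \<le> (\<Sum>i\<le>n. 2 * (D * real (n + 1) ^ 2 * exp (b * real n)))"
    proof (rule sum_mono)
      fix i assume "i \<in> {..n}"
      then have "2 * (D * real (i + 1) ^ 2 * exp (b * real i)) \<le>
          2 * (D * real (n + 1) ^ 2 * exp (b * real n))"
        using assms by (intro mult_left_mono mult_mono power_mono) (auto intro: mult_left_mono)
      with small [of i] show "real (card (word_sphere K i)) \<le>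
          2 * (D * real (n + 1) ^ 2 * exp (b * real n))"
        by linarith
    qed
    also have "\<dots> = 2 * D * exp (b * real n) * real (n + 1) ^ 3"
      by (simp add: power2_eq_square power3_eq_cube algebra_simps)
    also have "\<dots> \<le> 2 * D * exp (b * real n) * ((3 / \<epsilon>) ^ 3 * exp (\<epsilon> * real (n + 1)))"
    proof (intro mult_left_mono)
      \<comment> \<open>from \<open>x \<le> exp x\<close> at \<open>x = \<epsilon> (n + 1) / 3\<close>\<close>
      have "real (n + 1) ^ 3 = (3 / \<epsilon>) ^ 3 * (\<epsilon> * real (n + 1) / 3) ^ 3"
      proof -
        have "real (n + 1) = (3 / \<epsilon>) * (\<epsilon> * real (n + 1) / 3)"
          using eps by simp
        then show ?thesis
          by (metis power_mult_distrib)
      qed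
      also have "\<dots> \<le> (3 / \<epsilon>) ^ 3 * exp (\<epsilon> * real (n + 1) / 3) ^ 3"
        using eps less_imp_le [OF exp_gt_self] by (intro mult_left_mono power_mono) auto
      also have "exp (\<epsilon> * real (n + 1) / 3) ^ 3 = exp (\<epsilon> * real (n + 1))"
        by (simp add: exp_of_nat_mult [symmetric])
      finally show "real (n + 1) ^ 3 \<le> (3 / \<epsilon>) ^ 3 * exp (\<epsilon> * real (n + 1))" .
    qed (use assms in auto)
    also have "\<dots> = (2 * D * (3 / \<epsilon>) ^ 3 * exp \<epsilon>) * exp (b' * real n)"
      by (simp add: \<epsilon>_def algebra_simps mult_exp_exp)
    finally show ?thesis .
  qed
  then show False
    using assms(1) unfolding growth_at_most_def by blast
qed

text \<open>
  Let \<open>m\<close> be the mass of \<open>\<phi>\<close> on the cosets of small stabilizer and \<open>N\<close> the number of elements of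
  \<open>K\<close> of length \<open>n\<close>. Almost invariance gives at least \<open>N (m - \<eta>)\<close> for the quadratic form of the sum
  of the translations there, while the Schur test gives at most \<open>N m / 2\<close>. The length \<open>n\<close> depends
  only on \<open>K\<close>, so one sequence of ever more invariant vectors serves all subgroups \<open>K\<close> at once.
\<close>

lemma almost_invariant_mass_le:
  assumes K: "subgroup K G" and H: "subgroup H G" and "0 \<le> a" "a < b'"
    and "growth_at_most (2 * a) K" "\<not> growth_at_most b' K"
  obtains n where "\<And>F \<phi> \<eta>. \<lbrakk>finite F; F \<subseteq> lcosets H; \<And>C. C \<notin> F \<Longrightarrow> \<phi> C = (0::real);
      (\<Sum>C\<in>F. (\<phi> C)\<^sup>2) \<le> 1;
      \<And>s. s \<in> carrier G \<Longrightarrow> len s \<le> n \<Longrightarrow> 1 - \<eta> \<le> (\<Sum>C\<in>F. \<phi> C * \<phi> (s <# C))\<rbrakk>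
    \<Longrightarrow> (\<Sum>C\<in>F \<inter> small_stabilizer_cosets a K H. (\<phi> C)\<^sup>2) \<le> 2 * \<eta>"
proof -
  interpret K: subgroup K G by fact
  \<comment> \<open>room on both sides: convergence of the Poincare series needs \<open>a < b\<close>, and absorbing polynomial
    factors needs \<open>b < b'\<close>\<close>
  define b where "b = (a + b') / 2"
  have b: "a < b" "b < b'" "b \<ge> 0"
    using assms by (auto simp: b_def)
  have "growth_at_most (2 * b) K"
    using growth_at_most_mono [OF assms(5), of "2 * b"] b by simp
  then obtain C0 where C0: "\<And>n. real (card {g \<in> K. len g \<le> n}) \<le> C0 * exp (2 * b * real n)"
    by (auto simp: growth_at_most_def)
  define D where "D = C0 + 2 * real (card X) + 1"
  have "C0 \<ge> 0"
    using order_trans [OF _ C0 [of 0]] by simp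
  then have D: "D > 0"
    by (simp add: D_def)
  obtain n where n: "2 * (D * real (n + 1) ^ 2 * exp (b * real n)) \<le> real (card (word_sphere K n))"
    using exists_rich_sphere [OF assms(6) b(2,3) K.subset D] by blast
  define c where "c = D * real (n + 1) ^ 2 * exp (b * real n)"
  have c: "c > 0" "2 * c \<le> real (card (word_sphere K n))"
    using D n by (auto simp: c_def)
  let ?S = "small_stabilizer_cosets a K H" and ?Z = "word_sphere K n"
  obtain v where v: "\<And>C. C \<in> ?S \<Longrightarrow> v C > 0"
    "\<And>C. C \<in> ?S \<Longrightarrow> (\<Sum>z\<in>?Z. v (z <# C)) \<le> c * v C"
    using orbit_weight [OF K H \<open>0 \<le> a\<close> b(1) C0] unfolding c_def D_def by metis
  have act_inv: "inv z <# (z <# C) = C" "z <# (inv z <# C) = C"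
    if "z \<in> K" "C \<in> lcosets H" for z C
    using that lcoset_subset [OF H] by (simp_all add: lcos_m_assoc lcos_mult_one)
  have S_sub: "?S \<subseteq> lcosets H"
    by (auto simp: small_stabilizer_cosets_def)
  show thesis
  proof (rule that [of n])
    fix F \<phi> and \<eta> :: real
    assume F: "finite F" "F \<subseteq> lcosets H" and supp: "\<And>C. C \<notin> F \<Longrightarrow> \<phi> C = (0::real)"
      and norm: "(\<Sum>C\<in>F. (\<phi> C)\<^sup>2) \<le> 1"
      and inv: "\<And>s. s \<in> carrier G \<Longrightarrow> len s \<le> n \<Longrightarrow> 1 - \<eta> \<le> (\<Sum>C\<in>F. \<phi> C * \<phi> (s <# C))"
    let ?m = "\<Sum>C\<in>F \<inter> ?S. (\<phi> C)\<^sup>2"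
    have split: "sum f F = sum f (F \<inter> ?S) + sum f (F - ?S)" for f :: "'a set \<Rightarrow> real"
      using F(1) by (simp add: sum.Int_Diff)
    have lower: "?m - \<eta> \<le> (\<Sum>C\<in>F \<inter> ?S. \<phi> C * \<phi> (z <# C))" if z: "z \<in> ?Z" for z
    proof -
      have zK: "z \<in> K" and lz: "len z = n"
        using z by (auto simp: word_sphere_def)
      \<comment> \<open>on the complement, which \<open>z\<close> also preserves, the inner product is at most the mass there\<close>
      have stay: "z <# C \<notin> ?S" if "C \<in> F - ?S" for C
        using small_stabilizer_cosets_invariant [OF K H \<open>0 \<le> a\<close>, of "z <# C" "inv z"]
          act_inv(1) [OF zK] that F(2) zK by auto
      have inj: "inj_on (\<lambda>C. z <# C) (F - ?S)"
        by (rule inj_on_inverseI [of _ "\<lambda>C. inv z <# C"]) (use act_inv(1) [OF zK] F(2) in auto)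
      have "(\<Sum>C\<in>F - ?S. (\<phi> (z <# C))\<^sup>2) = (\<Sum>C\<in>(\<lambda>C. z <# C) ` (F - ?S). (\<phi> C)\<^sup>2)"
        using inj by (simp add: sum.reindex)
      also have "\<dots> = (\<Sum>C\<in>(\<lambda>C. z <# C) ` (F - ?S) \<inter> F. (\<phi> C)\<^sup>2)"
        using F(1) supp by (intro sum.mono_neutral_right) auto
      also have "\<dots> \<le> (\<Sum>C\<in>F - ?S. (\<phi> C)\<^sup>2)"
        using F(1) stay by (intro sum_mono2) auto
      finally have moved: "(\<Sum>C\<in>F - ?S. (\<phi> (z <# C))\<^sup>2) \<le> (\<Sum>C\<in>F - ?S. (\<phi> C)\<^sup>2)" .
      have "2 * (\<Sum>C\<in>F - ?S. \<phi> C * \<phi> (z <# C)) \<le> (\<Sum>C\<in>F - ?S. (\<phi> C)\<^sup>2 + (\<phi> (z <# C))\<^sup>2)"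
        unfolding sum_distrib_left
        by (intro sum_mono) (use sum_squares_bound in \<open>simp add: mult.assoc\<close>)
      then have "(\<Sum>C\<in>F - ?S. \<phi> C * \<phi> (z <# C)) \<le> (\<Sum>C\<in>F - ?S. (\<phi> C)\<^sup>2)"
        using moved by (simp add: sum.distrib)
      moreover have "1 - \<eta> \<le> (\<Sum>C\<in>F. \<phi> C * \<phi> (z <# C))"
        using inv [of z] zK lz by simp
      ultimately show ?thesis
        using norm split [of "\<lambda>C. \<phi> C * \<phi> (z <# C)"] split [of "\<lambda>C. (\<phi> C)\<^sup>2"] by linarith
    qed
    have "real (card ?Z) * (?m - \<eta>) \<le> (\<Sum>z\<in>?Z. \<Sum>C\<in>F \<inter> ?S. \<phi> C * \<phi> (z <# C))"
      using lower by (intro sum_bounded_below) auto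
    also have "\<dots> \<le> c * ?m"
    proof (rule schur_test [where iv = "m_inv G", OF F(1) _ _ _ _ v supp])
      show "z <# C \<in> ?S" if "z \<in> ?Z" "C \<in> ?S" for z C
        using small_stabilizer_cosets_invariant [OF K H \<open>0 \<le> a\<close>] that by (simp add: word_sphere_def)
    qed (use act_inv S_sub in \<open>auto simp: word_sphere_def len_inv\<close>)
    also have "\<dots> \<le> real (card ?Z) / 2 * ?m"
      using c by (intro mult_right_mono sum_nonneg) auto
    finally have "real (card ?Z) * (?m - \<eta>) \<le> real (card ?Z) * (?m / 2)"
      by simp
    then have "?m - \<eta> \<le> ?m / 2"
      using c by (subst (asm) mult_le_cancel_left_pos) auto
    then show "?m \<le> 2 * \<eta>"
      by linarith
  qed
qed

end

section \<open>Almost invariant functions on the cosets of a co-amenable subgroup\<close>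

text \<open>
  Take the averaging set to contain \<open>\<one>\<close>. If the average of the translates of a unit vector has norm
  close to \<open>1\<close>, then every inner product of two translates is close to \<open>1\<close>, in particular that of
  a translate with the vector itself. Absolute values only increase these inner products, so real vectors
  suffice, and finitely many cosets already capture almost all of the norm.
\<close>

lemma (in group) co_amenable_almost_invariant:
  assumes co: "co_amenable G H" and T: "finite T" "T \<subseteq> carrier G" and "\<eta> > 0"
  obtains F and \<phi> :: "'a set \<Rightarrow> real"
  where "finite F" "F \<subseteq> lcosets H" "\<And>C. C \<notin> F \<Longrightarrow> \<phi> C = 0" "(\<Sum>C\<in>F. (\<phi> C)\<^sup>2) \<le> 1"
    "\<And>s. s \<in> T \<Longrightarrow> 1 - \<eta> \<le> (\<Sum>C\<in>F. \<phi> C * \<phi> (s <# C))"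
proof -
  have H: "subgroup H G"
    using co by (simp add: co_amenable_def)
  define T' where "T' = insert \<one> (T \<union> m_inv G ` T)"
  have T': "finite T'" "T' \<noteq> {}" "T' \<subseteq> carrier G" "\<And>s. s \<in> T' \<Longrightarrow> inv s \<in> T'" "\<one> \<in> T'" "T \<subseteq> T'"
    using T by (auto simp: T'_def)
  define m where "m = real (card T')"
  have m: "m > 0"
    using T' by (simp add: m_def card_gt_0_iff)
  \<comment> \<open>each of the \<open>m\<^sup>2\<close> inner products is at most \<open>1\<close>, so if their mean exceeds \<open>r\<close>, each of them is
    at least \<open>1 - m\<^sup>2 (1 - r)\<close>\<close>
  define r where "r = max 0 (1 - \<eta> / m\<^sup>2)"
  have r: "0 \<le> r" "r < 1" "m\<^sup>2 * (1 - r) \<le> \<eta>"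
    using m \<open>\<eta> > 0\<close> by (auto simp: r_def max_def field_simps)
  let ?M = "markov_operator G T'"
  have "\<exists>f. f \<in> square_summable (lcosets H) \<and> l2_norm (lcosets H) f \<le> 1 \<and>
      sqrt r < l2_norm (lcosets H) (?M f)"
  proof (rule ccontr)
    assume "\<not> ?thesis"
    then have le: "l2_norm (lcosets H) (?M f) \<le> sqrt r"
      if "f \<in> square_summable (lcosets H)" "l2_norm (lcosets H) f \<le> 1" for f
      using that by force
    have "(\<lambda>_. 0) \<in> {f \<in> square_summable (lcosets H). l2_norm (lcosets H) f \<le> 1}"
      by (simp add: square_summable_def l2_norm_def)
    then have "cospectral_radius G T' H \<le> sqrt r"
      unfolding cospectral_radius_def l2_operator_norm_def
      using le by (intro cSUP_least) auto
    moreover have "cospectral_radius G T' H = 1"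
      using co T' by (simp add: co_amenable_def)
    ultimately show False
      using r by simp
  qed
  then obtain f where f: "f \<in> square_summable (lcosets H)" "l2_norm (lcosets H) f \<le> 1"
    and Mf: "sqrt r < l2_norm (lcosets H) (?M f)"
    by blast
  have Mf': "r < (\<Sum>\<^sub>\<infinity>C\<in>lcosets H. (cmod (?M f C))\<^sup>2)"
    using Mf by (simp add: l2_norm_def)
  have "(\<lambda>C. (cmod (?M f C))\<^sup>2) summable_on lcosets H"
    using Mf' r(1) infsum_not_exists by force
  then obtain E where E: "finite E" "E \<subseteq> lcosets H" "r < (\<Sum>C\<in>E. (cmod (?M f C))\<^sup>2)"
    using infsum_le_finite_sums [of "\<lambda>C. (cmod (?M f C))\<^sup>2" "lcosets H" r] Mf' by (meson not_le)
  define \<psi> where "\<psi> C = cmod (f C)" for C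
  have \<psi>_norm: "(\<Sum>C\<in>B. (\<psi> C)\<^sup>2) \<le> 1" if "finite B" "B \<subseteq> lcosets H" for B
  proof -
    have "(\<Sum>C\<in>B. (\<psi> C)\<^sup>2) \<le> (\<Sum>\<^sub>\<infinity>C\<in>lcosets H. (cmod (f C))\<^sup>2)"
      unfolding \<psi>_def using f(1) that
      by (intro finite_sum_le_infsum) (auto simp: square_summable_def)
    also have "\<dots> \<le> 1"
      using f(2) by (simp add: l2_norm_def)
    finally show ?thesis .
  qed
  define p where "p s t = (\<Sum>C\<in>E. \<psi> (s <# C) * \<psi> (t <# C))" for s t
  have translate_norm: "(\<Sum>C\<in>E. (\<psi> (s <# C))\<^sup>2) \<le> 1" if s: "s \<in> T'" for s
  proof -
    have sG: "s \<in> carrier G"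
      using s T'(3) by auto
    have "inj_on (\<lambda>C. s <# C) E"
      using E(2) lcoset_subset [OF H] sG
      by (intro inj_on_inverseI [of _ "\<lambda>C. inv s <# C"]) (auto simp: lcos_m_assoc lcos_mult_one)
    then have "(\<Sum>C\<in>E. (\<psi> (s <# C))\<^sup>2) = (\<Sum>C\<in>(\<lambda>C. s <# C) ` E. (\<psi> C)\<^sup>2)"
      by (simp add: sum.reindex)
    also have "\<dots> \<le> 1"
      using E lcoset_translate [OF H _ sG] by (intro \<psi>_norm) auto
    finally show ?thesis .
  qed
  have p_le: "p s t \<le> 1" if "s \<in> T'" "t \<in> T'" for s t
  proof -
    have "2 * p s t \<le> (\<Sum>C\<in>E. (\<psi> (s <# C))\<^sup>2 + (\<psi> (t <# C))\<^sup>2)"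
      unfolding p_def sum_distrib_left
      by (intro sum_mono) (use sum_squares_bound in \<open>simp add: mult.assoc\<close>)
    then show ?thesis
      using translate_norm [OF that(1)] translate_norm [OF that(2)] by (simp add: sum.distrib)
  qed
  have Mf_sq: "m\<^sup>2 * (cmod (?M f C))\<^sup>2 \<le> (\<Sum>s\<in>T'. \<Sum>t\<in>T'. \<psi> (s <# C) * \<psi> (t <# C))" for C
  proof -
    have "m * cmod (?M f C) = cmod (\<Sum>s\<in>T'. f (s <# C))"
      using m by (simp add: markov_operator_def norm_mult norm_divide m_def)
    also have "\<dots> \<le> (\<Sum>s\<in>T'. \<psi> (s <# C))"
      unfolding \<psi>_def by (rule norm_sum)
    finally have "(m * cmod (?M f C))\<^sup>2 \<le> (\<Sum>s\<in>T'. \<psi> (s <# C))\<^sup>2"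
      using m by (intro power_mono) auto
    then show ?thesis
      by (simp add: power_mult_distrib power2_eq_square [of "sum _ _"] sum_product)
  qed
  have "m\<^sup>2 * r < m\<^sup>2 * (\<Sum>C\<in>E. (cmod (?M f C))\<^sup>2)"
    using E(3) m by simp
  also have "\<dots> \<le> (\<Sum>C\<in>E. \<Sum>s\<in>T'. \<Sum>t\<in>T'. \<psi> (s <# C) * \<psi> (t <# C))"
    unfolding sum_distrib_left by (intro sum_mono Mf_sq)
  also have "\<dots> = (\<Sum>s\<in>T'. \<Sum>t\<in>T'. p s t)"
    unfolding p_def by (subst sum.swap, intro sum.cong refl, subst sum.swap) simp
  finally have total: "m\<^sup>2 * r < (\<Sum>s\<in>T'. \<Sum>t\<in>T'. p s t)" .
  have p_ge: "1 - \<eta> \<le> p \<one> s" if s: "s \<in> T'" for s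
  proof -
    have "1 - p \<one> s \<le> (\<Sum>(s, t)\<in>T' \<times> T'. 1 - p s t)"
      using T' s p_le member_le_sum [of "(\<one>, s)" "T' \<times> T'" "\<lambda>(s, t). 1 - p s t"] by auto
    also have "\<dots> = m\<^sup>2 - (\<Sum>s\<in>T'. \<Sum>t\<in>T'. p s t)"
      by (simp add: sum.cartesian_product [symmetric] sum_subtractf m_def power2_eq_square)
    also have "\<dots> \<le> m\<^sup>2 * (1 - r)"
      using total by (simp add: algebra_simps)
    finally show ?thesis
      using r by linarith
  qed
  \<comment> \<open>enlarge the support so that it contains the translates of \<open>E\<close>\<close>
  define F where "F = E \<union> (\<Union>s\<in>T. (\<lambda>C. s <# C) ` E)"
  define \<phi> where "\<phi> C = (if C \<in> F then \<psi> C else 0)" for C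
  have F: "finite F" "F \<subseteq> lcosets H"
    using E T lcoset_translate [OF H] by (auto simp: F_def)
  show thesis
  proof (rule that [of F \<phi>])
    show "(\<Sum>C\<in>F. (\<phi> C)\<^sup>2) \<le> 1"
      using \<psi>_norm [OF F] by (simp add: \<phi>_def)
    fix s assume s: "s \<in> T"
    have "1 - \<eta> \<le> p \<one> s"
      using p_ge s T' by auto
    also have "\<dots> = (\<Sum>C\<in>E. \<phi> C * \<phi> (s <# C))"
      unfolding p_def
    proof (intro sum.cong refl)
      fix C assume C: "C \<in> E"
      then have "\<one> <# C = C"
        using E(2) lcoset_subset [OF H] lcos_mult_one by blast
      moreover have "C \<in> F" "s <# C \<in> F"
        using C s by (auto simp: F_def)
      ultimately show "\<psi> (\<one> <# C) * \<psi> (s <# C) = \<phi> C * \<phi> (s <# C)"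
        by (simp add: \<phi>_def)
    qed
    also have "\<dots> \<le> (\<Sum>C\<in>F. \<phi> C * \<phi> (s <# C))"
      using F by (intro sum_mono2) (auto simp: F_def \<phi>_def \<psi>_def)
    finally show "1 - \<eta> \<le> (\<Sum>C\<in>F. \<phi> C * \<phi> (s <# C))" .
  qed (use F in \<open>auto simp: \<phi>_def\<close>)
qed

section \<open>Growth and the critical exponent\<close>

context finitely_generated_free_group
begin

abbreviation exponent :: "'a set \<Rightarrow> ereal" where
  "exponent \<equiv> critical_exponent G (symmetric_generators G X)"

lemma card_ball_subgroup_pos:
  assumes "subgroup K G"
  shows "card {g \<in> K. len g \<le> n} \<ge> 1"
proof -
  have "\<one> \<in> {g \<in> K. len g \<le> n}"
    using subgroup.one_closed [OF assms] by simp
  then show ?thesis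
    using finite_ball_inter [OF subgroup.subset [OF assms], of n]
    by (metis One_nat_def Suc_leI card_gt_0_iff empty_iff)
qed

lemma exponent_nonneg:
  assumes "subgroup K G"
  shows "0 \<le> exponent K"
proof -
  have "0 \<le> ereal (1 / real n * ln (real (card {g \<in> K. len g \<le> n})))" for n
    using card_ball_subgroup_pos [OF assms, of n] by simp
  then have "limsup (\<lambda>_. 0) \<le> exponent K"
    unfolding critical_exponent_def by (intro Limsup_mono) simp
  then show ?thesis
    by (simp add: Limsup_const)
qed

lemma exponent_mono:
  assumes "subgroup K G" "subgroup L G" "K \<subseteq> L"
  shows "exponent K \<le> exponent L"
  unfolding critical_exponent_def
proof (intro Limsup_mono always_eventually allI)
  fix n
  have "card {g \<in> K. len g \<le> n} \<le> card {g \<in> L. len g \<le> n}"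
    using assms(3) finite_ball_inter [OF subgroup.subset [OF assms(2)]] by (intro card_mono) auto
  then have "ln (real (card {g \<in> K. len g \<le> n})) \<le> ln (real (card {g \<in> L. len g \<le> n}))"
    using card_ball_subgroup_pos [OF assms(1), of n] by (intro ln_mono) auto
  then show "ereal (1 / real n * ln (real (card {g \<in> K. len g \<le> n}))) \<le>
      ereal (1 / real n * ln (real (card {g \<in> L. len g \<le> n})))"
    by (simp add: divide_right_mono)
qed

lemma growth_at_most_if_exponent_less:
  assumes K: "subgroup K G" and less: "exponent K < ereal s"
  shows "growth_at_most s K"
proof -
  have fin: "finite {g \<in> K. len g \<le> n}" for n
    using finite_ball_inter [OF subgroup.subset [OF K]] .
  have "s > 0"
    using exponent_nonneg [OF K] less by (metis ereal_less(2) order_le_less_trans)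
  have "eventually (\<lambda>n. ereal (1 / real n * ln (real (card {g \<in> K. len g \<le> n}))) < ereal s) sequentially"
    using less unfolding critical_exponent_def by (rule Limsup_lessD)
  then obtain m where m: "\<And>n. n \<ge> m \<Longrightarrow> 1 / real n * ln (real (card {g \<in> K. len g \<le> n})) < s"
    by (auto simp: eventually_sequentially)
  \<comment> \<open>\<open>Suc m\<close> keeps \<open>n\<close> positive in the second case below, where \<open>1 / n\<close> is cleared\<close>
  define C where "C = real (card {g \<in> K. len g \<le> Suc m})"
  have C: "C \<ge> 1"
    using card_ball_subgroup_pos [OF K, of "Suc m"] by (simp add: C_def)
  have "real (card {g \<in> K. len g \<le> n}) \<le> C * exp (s * real n)" for n
  proof (cases "n \<le> Suc m")
    case True
    have "card {g \<in> K. len g \<le> n} \<le> card {g \<in> K. len g \<le> Suc m}"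
      using True fin by (intro card_mono) auto
    then have "real (card {g \<in> K. len g \<le> n}) \<le> C * 1"
      by (simp add: C_def)
    also have "\<dots> \<le> C * exp (s * real n)"
      using C \<open>s > 0\<close> by (intro mult_left_mono) auto
    finally show ?thesis .
  next
    case False
    then have "ln (real (card {g \<in> K. len g \<le> n})) < s * real n"
      using m [of n] by (simp add: field_simps)
    then have "exp (ln (real (card {g \<in> K. len g \<le> n}))) \<le> exp (s * real n)"
      by simp
    then have "real (card {g \<in> K. len g \<le> n}) \<le> 1 * exp (s * real n)"
      using card_ball_subgroup_pos [OF K, of n] by (subst (asm) exp_ln) auto
    also have "\<dots> \<le> C * exp (s * real n)"
      using C by (intro mult_right_mono) auto
    finally show ?thesis .
  qed
  then show ?thesis
    by (auto simp: growth_at_most_def)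
qed

lemma exponent_le_if_growth_at_most:
  assumes K: "subgroup K G" and "growth_at_most s K"
  shows "exponent K \<le> ereal s"
proof -
  obtain C where C: "\<And>n. real (card {g \<in> K. len g \<le> n}) \<le> C * exp (s * real n)"
    using assms by (auto simp: growth_at_most_def)
  have pos: "real (card {g \<in> K. len g \<le> n}) \<ge> 1" for n
    using card_ball_subgroup_pos [OF K, of n] by simp
  have "C > 0"
    using order_trans [OF pos C [of 0]] by simp
  have "eventually (\<lambda>n. ereal (1 / real n * ln (real (card {g \<in> K. len g \<le> n}))) \<le>
      ereal (ln C / real n + s)) sequentially"
    using eventually_gt_at_top [of 0]
  proof eventually_elim
    case (elim n)
    have "ln (real (card {g \<in> K. len g \<le> n})) \<le> ln (C * exp (s * real n))"
      using C [of n] pos [of n] by (intro ln_mono) auto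
    also have "\<dots> = ln C + s * real n"
      using \<open>C > 0\<close> by (simp add: ln_mult)
    finally show ?case
      using elim by (simp add: field_simps)
  qed
  then have "exponent K \<le> limsup (\<lambda>n. ereal (ln C / real n + s))"
    unfolding critical_exponent_def by (rule Limsup_mono)
  also have "(\<lambda>n. ln C / real n + s) \<longlonglongrightarrow> 0 + s"
    by (intro tendsto_intros lim_const_over_n)
  then have "limsup (\<lambda>n. ereal (ln C / real n + s)) = ereal s"
    by (intro lim_imp_Limsup) auto
  finally show ?thesis .
qed

lemma exponent_finite:
  assumes K: "subgroup K G"
  shows "\<bar>exponent K\<bar> \<noteq> \<infinity>"
proof -
  let ?q = "2 * real (card X) + 1"
  have "real (card {g \<in> K. len g \<le> n}) \<le> 1 * exp (ln ?q * real n)" for n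
  proof -
    have "card {g \<in> K. len g \<le> n} \<le> card {g \<in> carrier G. len g \<le> n}"
      using subgroup.subset [OF K] finite_ball by (intro card_mono) auto
    then have "card {g \<in> K. len g \<le> n} \<le> (2 * card X + 1) ^ n"
      using card_ball_le [of n] by linarith
    then have "real (card {g \<in> K. len g \<le> n}) \<le> real ((2 * card X + 1) ^ n)"
      by (rule of_nat_mono)
    also have "\<dots> = ?q ^ n"
      by (simp add: add.commute)
    also have "\<dots> = exp (ln ?q * real n)"
    proof -
      have "exp (ln ?q * real n) = exp (ln ?q) ^ n"
        by (simp only: exp_of_nat2_mult)
      moreover have "exp (ln ?q) = ?q"
        by (rule exp_ln) (simp add: add_nonneg_pos)
      ultimately show ?thesis by simp
    qed
    finally show ?thesis by simp
  qed
  then have "growth_at_most (ln ?q) K"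
    unfolding growth_at_most_def by blast
  then have "exponent K \<le> ereal (ln ?q)"
    by (rule exponent_le_if_growth_at_most [OF K])
  with exponent_nonneg [OF K] show ?thesis
    by auto
qed

text \<open>
  The rate \<open>a\<close> lies above the exponent of the intersection but also above half the exponent of
  \<open>K\<close>, because the norm estimate on cosets of small stabilizer uses the growth rate \<open>2a\<close> of \<open>K\<close>.
\<close>

lemma exponent_drop_witness:
  assumes K: "subgroup K G" and H: "subgroup H G" and "exponent (H \<inter> K) \<noteq> exponent K"
  obtains a b where "a \<in> \<rat>" "b \<in> \<rat>" "0 \<le> a" "a < b" "growth_at_most a (K \<inter> H)"
    "growth_at_most (2 * a) K" "\<not> growth_at_most b K"
proof -
  have HK: "subgroup (H \<inter> K) G"
    using H K by (rule subgroups_Inter_pair)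
  obtain q r where q: "exponent (H \<inter> K) = ereal q" and r: "exponent K = ereal r"
    using exponent_finite K HK by (metis ereal_real)
  have "0 \<le> q" "q < r"
    using exponent_nonneg [OF HK] exponent_mono [OF HK K] assms(3) by (auto simp: q r)
  obtain a where a: "a \<in> \<rat>" "max q (r / 2) < a" "a < r"
    using Rats_dense_in_real [of "max q (r / 2)" r] \<open>0 \<le> q\<close> \<open>q < r\<close> by auto
  obtain b where b: "b \<in> \<rat>" "a < b" "b < r"
    using Rats_dense_in_real [OF a(3)] by auto
  show thesis
  proof (rule that [OF a(1) b(1) _ b(2)])
    show "growth_at_most a (K \<inter> H)"
      using growth_at_most_if_exponent_less [OF HK, of a] a q by (simp add: Int_commute)
    show "growth_at_most (2 * a) K"
      using growth_at_most_if_exponent_less [OF K, of "2 * a"] a r by simp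
    show "\<not> growth_at_most b K"
      using exponent_le_if_growth_at_most [OF K, of b] b r by auto
  qed (use a \<open>0 \<le> q\<close> in auto)
qed

end

section \<open>Measurability on the space of subgroups\<close>

lemma openin_subgroups_containing:
  assumes "h \<in> carrier G"
  shows "openin (subgroup_topology G) {K. subgroup K G \<and> h \<in> K}"
    and continuous_map_contains:
      "continuous_map (subgroup_topology G) (discrete_topology UNIV) (\<lambda>K. h \<in> K)"
proof -
  have "continuous_map (subgroup_topology G) (discrete_topology (UNIV :: bool set))
      ((\<lambda>f. f h) \<circ> (\<lambda>H. \<lambda>g\<in>carrier G. g \<in> H))"
    unfolding subgroup_topology_def
    by (intro continuous_map_pullback continuous_map_product_projection assms)
  then show cont: "continuous_map (subgroup_topology G) (discrete_topology UNIV) (\<lambda>K. h \<in> K)"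
    using assms by (simp add: comp_def)
  have "openin (subgroup_topology G) {K \<in> topspace (subgroup_topology G). (h \<in> K) \<in> {True}}"
    by (rule openin_continuous_map_preimage [OF cont]) simp
  then show "openin (subgroup_topology G) {K. subgroup K G \<and> h \<in> K}"
    by (simp add: topspace_subgroup_topology)
qed

lemma pred_contains [measurable (raw)]:
  assumes "h \<in> carrier G"
  shows "Measurable.pred (subgroup_borel G) (\<lambda>K. h \<in> K)"
  using openin_subgroups_containing [OF assms]
  by (simp add: Measurable.pred_def space_subgroup_borel sets_subgroup_borel sigma_sets.Basic)

lemma (in group) conjugate_subgroup_mem_iff:
  assumes "c \<in> carrier G" "g \<in> carrier G" "K \<subseteq> carrier G"
  shows "g \<in> conjugate_subgroup G c K \<longleftrightarrow> inv c \<otimes> g \<otimes> c \<in> K"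
proof
  assume "g \<in> conjugate_subgroup G c K"
  then obtain k where k: "k \<in> K" "g = c \<otimes> k \<otimes> inv c"
    by (auto simp: conjugate_subgroup_def)
  have "inv c \<otimes> g \<otimes> c = (inv c \<otimes> c) \<otimes> k \<otimes> (inv c \<otimes> c)"
    using k assms by (simp only: m_assoc m_closed inv_closed subsetD)
  then show "inv c \<otimes> g \<otimes> c \<in> K"
    using k assms by (simp add: subsetD)
next
  assume *: "inv c \<otimes> g \<otimes> c \<in> K"
  have "g = (c \<otimes> inv c) \<otimes> g \<otimes> (c \<otimes> inv c)"
    using assms by simp
  also have "\<dots> = c \<otimes> (inv c \<otimes> g \<otimes> c) \<otimes> inv c"
    using assms by (simp only: m_assoc m_closed inv_closed)
  finally show "g \<in> conjugate_subgroup G c K"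
    using * by (auto simp: conjugate_subgroup_def)
qed

lemma (in group) subgroup_conjugate_subgroup:
  assumes "c \<in> carrier G" "subgroup K G"
  shows "subgroup (conjugate_subgroup G c K) G"
proof -
  interpret K: subgroup K G by fact
  have sub: "conjugate_subgroup G c K \<subseteq> carrier G"
    using assms(1) by (auto simp: conjugate_subgroup_def)
  note mem = conjugate_subgroup_mem_iff [OF assms(1) _ K.subset]
  show ?thesis
  proof (rule subgroupI [OF sub])
    have "\<one> \<in> conjugate_subgroup G c K"
      using assms(1) by (simp add: mem)
    then show "conjugate_subgroup G c K \<noteq> {}"
      by auto
  next
    fix g assume g: "g \<in> conjugate_subgroup G c K"
    then have gG: "g \<in> carrier G" and gK: "inv c \<otimes> g \<otimes> c \<in> K"
      using sub mem by auto
    have "inv c \<otimes> inv g \<otimes> c = inv (inv c \<otimes> g \<otimes> c)"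
      using gG assms(1) by (simp add: inv_mult_group m_assoc)
    then show "inv g \<in> conjugate_subgroup G c K"
      using gG gK by (simp add: mem)
  next
    fix g h assume "g \<in> conjugate_subgroup G c K" "h \<in> conjugate_subgroup G c K"
    then have gh: "g \<in> carrier G" "h \<in> carrier G" "inv c \<otimes> g \<otimes> c \<in> K" "inv c \<otimes> h \<otimes> c \<in> K"
      using sub mem by auto
    have "inv c \<otimes> (g \<otimes> h) \<otimes> c = inv c \<otimes> g \<otimes> (c \<otimes> inv c) \<otimes> h \<otimes> c"
      using gh assms(1) by (simp add: m_assoc)
    also have "\<dots> = (inv c \<otimes> g \<otimes> c) \<otimes> (inv c \<otimes> h \<otimes> c)"
      using gh(1,2) assms(1) by (simp only: m_assoc m_closed inv_closed)
    finally show "g \<otimes> h \<in> conjugate_subgroup G c K"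
      using gh by (simp add: mem)
  qed
qed

lemma (in group) measurable_conjugate_subgroup:
  assumes c: "c \<in> carrier G"
  shows "conjugate_subgroup G c \<in> measurable (subgroup_borel G) (subgroup_borel G)"
proof -
  let ?T = "subgroup_topology G"
  have component: "continuous_map ?T (discrete_topology UNIV) (\<lambda>K. g \<in> conjugate_subgroup G c K)"
    if g: "g \<in> carrier G" for g
  proof (rule continuous_map_eq)
    show "continuous_map ?T (discrete_topology UNIV) (\<lambda>K. inv c \<otimes> g \<otimes> c \<in> K)"
      using c g by (intro continuous_map_contains) auto
    show "(inv c \<otimes> g \<otimes> c \<in> K) = (g \<in> conjugate_subgroup G c K)" if "K \<in> topspace ?T" for K
    proof -
      have "K \<subseteq> carrier G"
        using that by (simp add: topspace_subgroup_topology subgroup.subset)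
      then show ?thesis
        using conjugate_subgroup_mem_iff [OF c g] by simp
    qed
  qed
  have cont: "continuous_map ?T ?T (conjugate_subgroup G c)"
    unfolding subgroup_topology_def [of G]
  proof (rule continuous_map_pullback', unfold subgroup_topology_def [of G, symmetric])
    show "continuous_map ?T (product_topology (\<lambda>_. discrete_topology UNIV) (carrier G))
        ((\<lambda>H. \<lambda>g\<in>carrier G. g \<in> H) \<circ> conjugate_subgroup G c)"
      unfolding continuous_map_componentwise
    proof (intro conjI ballI)
      fix g assume g: "g \<in> carrier G"
      show "continuous_map ?T (discrete_topology UNIV)
          (\<lambda>K. ((\<lambda>H. \<lambda>g\<in>carrier G. g \<in> H) \<circ> conjugate_subgroup G c) K g)"
        using component [OF g] g by (simp only: comp_def restrict_apply if_True)
    qed auto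
    show "topspace ?T \<subseteq> conjugate_subgroup G c -` {H. subgroup H G}"
      using subgroup_conjugate_subgroup [OF c] by (auto simp: topspace_subgroup_topology)
  qed
  show ?thesis
    unfolding subgroup_borel_def [of G]
  proof (rule measurable_measure_of, unfold subgroup_borel_def [of G, symmetric])
    show "{U. openin ?T U} \<subseteq> Pow (topspace ?T)"
      by (auto dest: openin_subset)
    show "conjugate_subgroup G c \<in> space (subgroup_borel G) \<rightarrow> topspace ?T"
      using subgroup_conjugate_subgroup [OF c]
      by (auto simp: topspace_subgroup_topology space_subgroup_borel)
    fix U assume "U \<in> {U. openin ?T U}"
    then have "openin ?T {K \<in> topspace ?T. conjugate_subgroup G c K \<in> U}"
      using openin_continuous_map_preimage [OF cont] by auto
    moreover have "conjugate_subgroup G c -` U \<inter> space (subgroup_borel G) =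
        {K \<in> topspace ?T. conjugate_subgroup G c K \<in> U}"
      by (auto simp: topspace_subgroup_topology space_subgroup_borel)
    ultimately show "conjugate_subgroup G c -` U \<inter> space (subgroup_borel G) \<in> sets (subgroup_borel G)"
      by (simp add: sets_subgroup_borel sigma_sets.Basic)
  qed
qed

context finitely_generated_free_group
begin

lemma pred_growth_at_most:
  assumes A: "A \<subseteq> carrier G"
  shows "Measurable.pred (subgroup_borel G) (\<lambda>K. growth_at_most s (K \<inter> A))"
proof -
  have count: "real (card {g \<in> K \<inter> A. len g \<le> n}) =
      (\<Sum>g\<in>{g \<in> A. len g \<le> n}. if g \<in> K then 1 else 0)" for K n
  proof -
    have "{g \<in> A. len g \<le> n} \<inter> {g. g \<in> K} = {g \<in> K \<inter> A. len g \<le> n}"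
      by auto
    then show ?thesis
      using finite_ball_inter [OF A, of n] by (simp add: sum.If_cases)
  qed
  \<comment> \<open>only the finitely many coordinates in a ball matter\<close>
  have [measurable]: "(\<lambda>K. real (card {g \<in> K \<inter> A. len g \<le> n})) \<in> borel_measurable (subgroup_borel G)" for n
    unfolding count
  proof (intro borel_measurable_sum)
    fix g assume "g \<in> {g \<in> A. len g \<le> n}"
    then have [measurable]: "Measurable.pred (subgroup_borel G) (\<lambda>K. g \<in> K)"
      using A by (intro pred_contains) auto
    show "(\<lambda>K. if g \<in> K then 1 else 0 :: real) \<in> borel_measurable (subgroup_borel G)"
      by measurable
  qed
  \<comment> \<open>an integer constant turns the existential quantifier into a countable union\<close>
  have "growth_at_most s B \<longleftrightarrow>
      (\<exists>N::nat. \<forall>n. real (card {g \<in> B. len g \<le> n}) \<le> real N * exp (s * real n))" for B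
  proof
    assume "growth_at_most s B"
    then obtain C where C: "\<And>n. real (card {g \<in> B. len g \<le> n}) \<le> C * exp (s * real n)"
      by (auto simp: growth_at_most_def)
    obtain N :: nat where "C \<le> real N"
      using real_arch_simple by blast
    then have "C * exp (s * real n) \<le> real N * exp (s * real n)" for n
      by (intro mult_right_mono) auto
    then show "\<exists>N::nat. \<forall>n. real (card {g \<in> B. len g \<le> n}) \<le> real N * exp (s * real n)"
      using C order_trans by blast
  qed (auto simp: growth_at_most_def)
  then have "Measurable.pred (subgroup_borel G) (\<lambda>K. growth_at_most s (K \<inter> A)) \<longleftrightarrow>
    Measurable.pred (subgroup_borel G)
      (\<lambda>K. \<exists>N::nat. \<forall>n. real (card {g \<in> K \<inter> A. len g \<le> n}) \<le> real N * exp (s * real n))"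
    by simp
  also have \<dots>
    by measurable
  finally show ?thesis .
qed

end

section \<open>Invariant random subgroups\<close>

lemma (in group) translate_lcoset_eq_iff:
  assumes "subgroup H G" "c \<in> carrier G" "k \<in> carrier G"
  shows "k <# (c <# H) = c <# H \<longleftrightarrow> inv c \<otimes> k \<otimes> c \<in> H"
proof -
  interpret H: subgroup H G by fact
  have "k <# (c <# H) = (k \<otimes> c) <# H"
    using assms H.subset by (simp add: lcos_m_assoc)
  moreover have "(k \<otimes> c) <# H = c <# H \<longleftrightarrow> k \<otimes> c \<in> c <# H"
    using assms lcos_self [of "k \<otimes> c" H] l_repr_independence [of "k \<otimes> c" c H] by auto
  moreover have "k \<otimes> c \<in> c <# H \<longleftrightarrow> inv c \<otimes> (k \<otimes> c) \<in> H"
    using assms H.lcos_module_imp [OF is_group, of c "k \<otimes> c"]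
      H.lcos_module_rev [OF is_group, of c "k \<otimes> c"] by auto
  ultimately show ?thesis
    using assms by (simp add: m_assoc)
qed

context finitely_generated_free_group
begin

lemma coset_stabilizer_conjugate:
  assumes K: "subgroup K G" and H: "subgroup H G" and c: "c \<in> carrier G"
  shows "conjugate_subgroup G (inv c) K \<inter> H =
    conjugate_subgroup G (inv c) (coset_stabilizer K (c <# H))"
proof -
  have KG: "k \<in> carrier G" if "k \<in> K" for k
    using subgroup.mem_carrier [OF K that] .
  show ?thesis
    using translate_lcoset_eq_iff [OF H c KG] c
    by (auto simp: conjugate_subgroup_def coset_stabilizer_def)
qed

text \<open>
  Call \<open>K\<close> rich if it satisfies the two growth conditions on \<open>K\<close> itself, and let \<open>A C\<close> be the event that \<open>K\<close> is rich
  and the coset \<open>C\<close> has small stabilizer; \<open>A H\<close> is the event in question. All \<open>A C\<close> have the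
  same probability by conjugation invariance. For almost invariant \<open>\<phi> j\<close> of norm about \<open>1\<close>, the
  random mass \<open>f j\<close> of \<open>\<phi> j\<close> on the cosets \<open>C\<close> for which \<open>A C\<close> occurs therefore has expectation about
  \<open>prob (A H)\<close>, but it converges to \<open>0\<close> for every \<open>K\<close>.
\<close>

lemma AE_no_growth_drop:
  assumes prob: "prob_space \<mu>" and sets: "sets \<mu> = sets (subgroup_borel G)"
    and inv: "conjugation_invariant G \<mu>" and co: "co_amenable G H" and ab: "0 \<le> a" "a < b"
  shows "AE K in \<mu>. \<not> (growth_at_most a (K \<inter> H) \<and> growth_at_most (2 * a) K \<and> \<not> growth_at_most b K)"
proof -
  interpret prob_space \<mu> by fact
  have H: "subgroup H G"
    using co by (simp add: co_amenable_def)
  have HG: "H \<subseteq> carrier G"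
    using H by (rule subgroup.subset)
  have space: "space \<mu> = {K. subgroup K G}"
    using sets_eq_imp_space_eq [OF sets] by (simp add: space_subgroup_borel)
  define rich where "rich K \<longleftrightarrow> growth_at_most (2 * a) K \<and> \<not> growth_at_most b K" for K
  define A where "A C = {K \<in> space \<mu>. rich K \<and> growth_at_most a (coset_stabilizer K C)}" for C
  have pred_growth: "Measurable.pred \<mu> (\<lambda>K. growth_at_most s (K \<inter> B))" if "B \<subseteq> carrier G" for s B
    using pred_growth_at_most [OF that, of s] by (simp add: measurable_cong_sets [OF sets refl])
  have A_sets: "A C \<in> sets \<mu>" for C
  proof -
    have eq: "A C = {K \<in> space \<mu>. (growth_at_most (2 * a) (K \<inter> carrier G) \<and>
        \<not> growth_at_most b (K \<inter> carrier G)) \<and>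
        growth_at_most a (K \<inter> {k \<in> carrier G. k <# C = C})}"
    proof -
      have "K \<inter> carrier G = K \<and> K \<inter> {k \<in> carrier G. k <# C = C} = coset_stabilizer K C"
        if "K \<in> space \<mu>" for K
        using that subgroup.subset [of K G] by (auto simp: space coset_stabilizer_def)
      then show ?thesis
        by (auto simp: A_def rich_def)
    qed
    have [measurable]: "Measurable.pred \<mu> (\<lambda>K. growth_at_most s (K \<inter> carrier G))"
      "Measurable.pred \<mu> (\<lambda>K. growth_at_most s (K \<inter> {k \<in> carrier G. k <# C = C}))" for s
      by (intro pred_growth; auto)+
    show ?thesis
      unfolding eq by measurable
  qed
  have prob_A: "prob (A C) = prob (A H)" if C: "C \<in> lcosets H" for C
  proof -
    obtain c where c: "c \<in> carrier G" "C = c <# H"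
      using C by (auto simp: LCOSETS_def)
    let ?c = "conjugate_subgroup G (inv c)"
    have meas: "?c \<in> measurable \<mu> \<mu>"
      using measurable_conjugate_subgroup [of "inv c"] c(1)
      by (simp add: measurable_cong_sets [OF sets sets])
    have growth: "growth_at_most s (?c B) \<longleftrightarrow> growth_at_most s B"
      if "B \<subseteq> carrier G" "s \<ge> 0" for s B
      using growth_at_most_conjugate_iff [of s B "inv c"] that c(1)
      by (simp add: conjugate_subgroup_def)
    have "A C = ?c -` A H \<inter> space \<mu>"
    proof -
      have "?c K \<in> A H \<longleftrightarrow> rich K \<and> growth_at_most a (coset_stabilizer K C)" if K: "K \<in> space \<mu>" for K
      proof -
        have sK: "subgroup K G" and sC: "subgroup (?c K) G"
          using K subgroup_conjugate_subgroup [of "inv c" K] c(1) by (auto simp: space)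
        have sC': "coset_stabilizer K C \<subseteq> carrier G"
          using subgroup.subset [OF sK] by (auto simp: coset_stabilizer_def)
        have "coset_stabilizer (?c K) H = ?c K \<inter> H"
          using translate_lcoset_eq_iff [OF H one_closed] subgroup.mem_carrier [OF sC] lcos_mult_one [OF HG]
          by (auto simp: coset_stabilizer_def)
        also have "\<dots> = ?c (coset_stabilizer K C)"
          using coset_stabilizer_conjugate [OF sK H c(1)] c(2) by simp
        finally have "growth_at_most a (coset_stabilizer (?c K) H) \<longleftrightarrow>
            growth_at_most a (coset_stabilizer K C)"
          using growth [OF sC' ab(1)] by simp
        moreover have "rich (?c K) \<longleftrightarrow> rich K"
          using growth [OF subgroup.subset [OF sK], of "2 * a"]
            growth [OF subgroup.subset [OF sK], of b] ab by (simp add: rich_def)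
        ultimately show ?thesis
          using sC by (simp add: A_def space)
      qed
      then show ?thesis
        unfolding A_def [of C] by blast
    qed
    then have "prob (A C) = measure (distr \<mu> \<mu> ?c) (A H)"
      by (simp add: measure_distr [OF meas A_sets])
    also have "distr \<mu> \<mu> ?c = \<mu>"
      using inv c(1) by (simp add: conjugation_invariant_def)
    finally show ?thesis .
  qed
  define almost where "almost j F \<phi> \<longleftrightarrow> finite F \<and> F \<subseteq> lcosets H \<and>
      (\<forall>C. C \<notin> F \<longrightarrow> \<phi> C = (0::real)) \<and> (\<Sum>C\<in>F. (\<phi> C)\<^sup>2) \<le> 1 \<and>
      (\<forall>s\<in>carrier G. len s \<le> j \<longrightarrow> 1 - 1 / real (Suc j) \<le> (\<Sum>C\<in>F. \<phi> C * \<phi> (s <# C)))"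
    for j F and \<phi> :: "'a set \<Rightarrow> real"
  have "\<exists>F \<phi>. almost j F \<phi>" for j
  proof -
    obtain F and \<phi> :: "'a set \<Rightarrow> real" where "finite F" "F \<subseteq> lcosets H"
      "\<And>C. C \<notin> F \<Longrightarrow> \<phi> C = 0" "(\<Sum>C\<in>F. (\<phi> C)\<^sup>2) \<le> 1"
      "\<And>s. s \<in> {g \<in> carrier G. len g \<le> j} \<Longrightarrow> 1 - 1 / real (Suc j) \<le> (\<Sum>C\<in>F. \<phi> C * \<phi> (s <# C))"
      by (rule co_amenable_almost_invariant [OF co finite_ball [of j], of "1 / real (Suc j)"]) auto
    then have "almost j F \<phi>"
      unfolding almost_def by blast
    then show ?thesis by blast
  qed
  then obtain F \<phi> where "\<And>j. almost j (F j) (\<phi> j)"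
    by metis
  then have F\<phi>: "finite (F j)" "F j \<subseteq> lcosets H" "\<And>C. C \<notin> F j \<Longrightarrow> \<phi> j C = 0"
      "(\<Sum>C\<in>F j. (\<phi> j C)\<^sup>2) \<le> 1"
      "\<And>s. s \<in> carrier G \<Longrightarrow> len s \<le> j \<Longrightarrow>
        1 - 1 / real (Suc j) \<le> (\<Sum>C\<in>F j. \<phi> j C * \<phi> j (s <# C))" for j
    unfolding almost_def by blast+
  define f where "f j K = (\<Sum>C\<in>F j. (\<phi> j C)\<^sup>2 * indicator (A C) K)" for j K
  have f_le: "f j K \<le> (\<Sum>C\<in>F j. (\<phi> j C)\<^sup>2)" and f_nonneg: "0 \<le> f j K" for j K
    unfolding f_def by (auto intro!: sum_mono sum_nonneg simp: indicator_def)
  have f_lim: "(\<lambda>j. f j K) \<longlonglongrightarrow> 0" if K: "K \<in> space \<mu>" for K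
  proof (cases "rich K")
    case False
    then have "f j K = 0" for j
      by (simp add: f_def A_def)
    then show ?thesis by simp
  next
    case True
    have sK: "subgroup K G"
      using K by (simp add: space)
    obtain n where n: "\<And>F \<phi> \<eta>. \<lbrakk>finite F; F \<subseteq> lcosets H; \<And>C. C \<notin> F \<Longrightarrow> \<phi> C = (0::real);
        (\<Sum>C\<in>F. (\<phi> C)\<^sup>2) \<le> 1;
        \<And>s. s \<in> carrier G \<Longrightarrow> len s \<le> n \<Longrightarrow> 1 - \<eta> \<le> (\<Sum>C\<in>F. \<phi> C * \<phi> (s <# C))\<rbrakk>
        \<Longrightarrow> (\<Sum>C\<in>F \<inter> small_stabilizer_cosets a K H. (\<phi> C)\<^sup>2) \<le> 2 * \<eta>"
      using almost_invariant_mass_le [OF sK H ab] True unfolding rich_def by blast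
    have bound: "f j K \<le> 2 * (1 / real (Suc j))" if "j \<ge> n" for j
    proof -
      have "f j K = (\<Sum>C\<in>F j \<inter> small_stabilizer_cosets a K H. (\<phi> j C)\<^sup>2)"
        unfolding f_def using F\<phi>(1) [of j] F\<phi>(2) [of j] K True
        by (intro sum.mono_neutral_cong_right) (auto simp: A_def small_stabilizer_cosets_def indicator_def)
      also have "\<dots> \<le> 2 * (1 / real (Suc j))"
        by (rule n [OF F\<phi>(1,2,3,4)]) (use F\<phi>(5) [of _ j] that in auto)
      finally show ?thesis .
    qed
    show ?thesis
    proof (rule tendsto_sandwich)
      show "(\<lambda>_. 0 :: real) \<longlonglongrightarrow> 0" by simp
      have "(\<lambda>j. 2 * (1 / real (Suc j))) \<longlonglongrightarrow> 2 * 0"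
        by (intro tendsto_intros LIMSEQ_Suc [OF lim_1_over_n])
      then show "(\<lambda>j. 2 * (1 / real (Suc j))) \<longlonglongrightarrow> 0" by simp
      show "eventually (\<lambda>j. f j K \<le> 2 * (1 / real (Suc j))) sequentially"
        using bound by (auto simp: eventually_sequentially)
    qed (simp add: f_nonneg)
  qed
  have "(\<lambda>j. integral\<^sup>L \<mu> (f j)) \<longlonglongrightarrow> integral\<^sup>L \<mu> (\<lambda>_. 0)"
  proof (rule integral_dominated_convergence [where w = "\<lambda>_. 1"])
    show "f j \<in> borel_measurable \<mu>" for j
      unfolding f_def using A_sets by measurable
    show "AE K in \<mu>. norm (f j K) \<le> 1" for j
      using order_trans [OF f_le F\<phi>(4)] f_nonneg by (intro AE_I2) simp
  qed (use f_lim in auto)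
  then have lim: "(\<lambda>j. integral\<^sup>L \<mu> (f j)) \<longlonglongrightarrow> 0"
    by simp
  have "(1 - 1 / real (Suc j)) * prob (A H) \<le> integral\<^sup>L \<mu> (f j)" for j
  proof -
    have "1 - 1 / real (Suc j) \<le> (\<Sum>C\<in>F j. \<phi> j C * \<phi> j (\<one> <# C))"
      using F\<phi>(5) [OF one_closed, of j] by simp
    also have "\<dots> = (\<Sum>C\<in>F j. (\<phi> j C)\<^sup>2)"
      using F\<phi>(2) [of j] lcoset_subset [OF H] lcos_mult_one
      by (intro sum.cong) (auto simp: power2_eq_square subset_iff)
    finally have "(1 - 1 / real (Suc j)) * prob (A H) \<le> (\<Sum>C\<in>F j. (\<phi> j C)\<^sup>2) * prob (A H)"
      by (intro mult_right_mono) auto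
    also have "\<dots> = (\<Sum>C\<in>F j. (\<phi> j C)\<^sup>2 * prob (A C))"
      using F\<phi>(2) [of j] prob_A by (simp add: sum_distrib_right subset_iff)
    also have "\<dots> = integral\<^sup>L \<mu> (f j)"
      unfolding f_def using A_sets
      by (subst Bochner_Integration.integral_sum) (auto simp: emeasure_eq_measure)
    finally show ?thesis .
  qed
  moreover have "(\<lambda>j. (1 - 1 / real (Suc j)) * prob (A H)) \<longlonglongrightarrow> (1 - 0) * prob (A H)"
    by (intro tendsto_intros LIMSEQ_Suc [OF lim_1_over_n])
  ultimately have "(1 - 0) * prob (A H) \<le> 0"
    using lim by (intro LIMSEQ_le) auto
  then have "prob (A H) = 0"
    by (simp add: measure_le_0_iff)
  then have "A H \<in> null_sets \<mu>"
    using A_sets by (simp add: null_sets_def emeasure_eq_measure)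
  moreover have "{K \<in> space \<mu>. \<not> \<not> (growth_at_most a (K \<inter> H) \<and> growth_at_most (2 * a) K \<and>
      \<not> growth_at_most b K)} \<subseteq> A H"
  proof (rule subsetI)
    fix K assume "K \<in> {K \<in> space \<mu>. \<not> \<not> (growth_at_most a (K \<inter> H) \<and>
      growth_at_most (2 * a) K \<and> \<not> growth_at_most b K)}"
    then have *: "K \<in> space \<mu>" "growth_at_most a (K \<inter> H)" "growth_at_most (2 * a) K"
      "\<not> growth_at_most b K"
      by auto
    have "coset_stabilizer K H = K \<inter> H"
      using translate_lcoset_eq_iff [OF H one_closed] subgroup.mem_carrier [of K G] *(1) lcos_mult_one [OF HG]
      by (auto simp: coset_stabilizer_def space)
    with * show "K \<in> A H"
      by (simp add: A_def rich_def)
  qed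
  ultimately show ?thesis
    by (rule AE_I')
qed

end

theorem corollary1p5:
  fixes G :: "('a, 'm) monoid_scheme" and X S H1 :: "'a set" and d :: nat
    and P :: "'w measure" and H2 :: "'w \<Rightarrow> 'a set"
  assumes "group G"
    and "free_basis G X" and "finite X" and "card X = d" and "d \<ge> 2"
    and "S = symmetric_generators G X"
    and "co_amenable G H1"
    and "ergodic_invariant_random_subgroup G P H2"
  shows "AE \<omega> in P. critical_exponent G S (H1 \<inter> H2 \<omega>) = critical_exponent G S (H2 \<omega>)"
proof -
  interpret finitely_generated_free_group G X
    using assms by (simp add: finitely_generated_free_group_def finitely_generated_free_group_axioms_def)
  interpret P: prob_space P
    using assms(8) by (simp add: ergodic_invariant_random_subgroup_def)
  have H2: "H2 \<in> measurable P (subgroup_borel G)"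
    and inv: "conjugation_invariant G (distr P (subgroup_borel G) H2)"
    using assms(8) by (auto simp: ergodic_invariant_random_subgroup_def)
  have H1: "subgroup H1 G"
    using assms(7) by (simp add: co_amenable_def)
  have "AE K in distr P (subgroup_borel G) H2. \<forall>a\<in>\<rat>. \<forall>b\<in>\<rat>. 0 \<le> a \<and> a < b \<longrightarrow>
      \<not> (growth_at_most a (K \<inter> H1) \<and> growth_at_most (2 * a) K \<and> \<not> growth_at_most b K)"
    unfolding AE_ball_countable [OF countable_rat]
    using AE_no_growth_drop [OF P.prob_space_distr [OF H2] _ inv assms(7)] by auto
  then have "AE \<omega> in P. \<forall>a\<in>\<rat>. \<forall>b\<in>\<rat>. 0 \<le> a \<and> a < b \<longrightarrow>
      \<not> (growth_at_most a (H2 \<omega> \<inter> H1) \<and> growth_at_most (2 * a) (H2 \<omega>) \<and> \<not> growth_at_most b (H2 \<omega>))"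
    by (rule AE_distrD [OF H2])
  then show ?thesis
  proof (rule AE_mp, intro AE_I2 impI)
    fix \<omega> assume \<omega>: "\<omega> \<in> space P"
      and *: "\<forall>a\<in>\<rat>. \<forall>b\<in>\<rat>. 0 \<le> a \<and> a < b \<longrightarrow>
      \<not> (growth_at_most a (H2 \<omega> \<inter> H1) \<and> growth_at_most (2 * a) (H2 \<omega>) \<and> \<not> growth_at_most b (H2 \<omega>))"
    have "subgroup (H2 \<omega>) G"
      using measurable_space [OF H2 \<omega>] by (simp add: space_subgroup_borel)
    then show "critical_exponent G S (H1 \<inter> H2 \<omega>) = critical_exponent G S (H2 \<omega>)"
      unfolding assms(6) using exponent_drop_witness [OF _ H1, of "H2 \<omega>"] * by metis
  qed
qed

end
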